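(* Let the set of all monomials on $c_0$ be arranged in a sequence by a compatible order (with respect to the square order on the monomials of each fixed degree). Then this sequence of monomials is a Schauder basis for $(\mathcal{H}(c_0),\tau_\omega)$ and is a Schauder basis for $(\mathcal{H}_b(c_0),\tau_b)$.
   Context: $c_0=\{(z_j)_{j\ge 1}\subset\mathbb{C}:\lim_{j\to\infty}z_j=0\}$ with the supremum norm, and $c_0^+$ is the set of null sequences with all terms strictly positive (indexed from $1$ or from $0$ as needed). Schauder basis: a sequence $(f_k)_{k=1}^\infty$ in a locally convex space $E$ is a Schauder basis if for each $x\in E$ there is a unique sequence of scalars $(x_k)_{k=1}^\infty$ such that $x=\sum_{k=1}^\infty x_kf_k:=\lim_{N\to\infty}\sum_{k=1}^N x_kf_k$ in the topology of $E$. Monomials: let $\mathbb{N}^{(\mathbb{N})}$ be the set of sequences $m=(m_i)_{i\ge1}$ of non-negative integers that are eventually zero. Put $|m|=\sum_i m_i$ (modulus) and $l(m)=\sup\{i:m_i\neq0\}$ (length). The monomial associated with $m$ is the function $z=(z_j)_j\in c_0\mapsto z^m:=z_1^{m_1}z_2^{m_2}\cdots$, with the convention $0^0=1$; its degree is $|m|$. Square order: for $m,m'\in\mathbb{N}^{(\mathbb{N})}$ with $|m|=|m'|$, $m<m'$ if either $l(m)<l(m')$, or $l(m)=l(m')$ and for some positive integer $s\le l(m)$ one has $m_s<m'_s$ and $m_t=m'_t$ for all $t>s$. For each $n\ge1$ this arranges the monomials of degree $n$ in a sequence $(P_{n,m})_{m=1}^\infty$; there is a single monomial of degree $0$, the constant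 $1$. Compatible order: an arrangement (bijective enumeration by the positive integers) of the set of all monomials into a sequence such that, for each $n$, the monomials of degree $n$ occur in the sequence in their square order; that is, for every $n$, $P_{n,m}$ occurs before $P_{n,\overline m}$ whenever $m<\overline m$. Spaces: $\mathcal{P}(^nc_0)$ is the space of continuous $n$-homogeneous polynomials on $c_0$ (constants for $n=0$). $\mathcal{H}(c_0)$ is the space of all complex-valued holomorphic functions on $c_0$ (entire functions), and $\tau_\omega$ is the Nachbin ported topology on it: the locally convex topology generated by all semi-norms $p$ for which there is a compact set $K\subset c_0$ such that for every open $V\supset K$ there is $C(V)>0$ with $p(f)\le C(V)\sup_{z\in V}|f(z)|$ for all $f\in\mathcal{H}(c_0)$. Equivalently, a fundamental system of semi-norms for $(\mathcal{H}(c_0),\tau_\omega)$ is given by $$p\Big(\sum_{n=0}^\infty P_n\Big)=\sum_{n=0}^\infty\sup\{|P_n(z)|: z=(z_j)_j\in c_0,\ |z_j|\le\beta_j+\alpha_n \text{ for all } j\},$$ where $\sum_{n=0}^\infty P_n$, $P_n\in\mathcal{P}(^nc_0)$, is the Taylor series at the origin of the function, and $(\beta_j)_{j\ge1}$ and $(\alpha_n)_{n\ge0}$ range over $c_0^+$. $\mathcal{H}_b(c_0)$ is the subspace of all $f\in\mathcal{H}(c_0)$ that are bounded on each bounded subset of $c_0$, and $\tau_b$ is the topology of uniform convergence on the bounded subsets of $c_0$. *)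

theory Defs
  imports "HOL-Complex_Analysis.Complex_Analysis" "HOL-Library.Poly_Mapping"
begin

text \<open>
  Coordinates of sequences and positions in enumerations are indexed by \<^typ>\<open>nat\<close>, hence from 0.
\<close>

typedef c0 = "{z :: nat \<Rightarrow> complex. z \<longlonglongrightarrow> 0}"
  morphisms coord Abs_c0
  by (rule exI[of _ "\<lambda>_. 0"]) simp

setup_lifting type_definition_c0

lemma coord_tendsto: "coord z \<longlonglongrightarrow> 0"
  using coord[of z] by simp

lemma bdd_above_coord: "bdd_above (range (\<lambda>j. cmod (coord z j)))"
proof -
  have "bounded (range (coord z))"
    using coord_tendsto convergent_imp_bounded by blast
  then obtain B where "\<And>j. cmod (coord z j) \<le> B"
    by (auto simp: bounded_iff)
  then show ?thesis by (intro bdd_aboveI2)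
qed

instantiation c0 :: real_normed_vector
begin

lift_definition zero_c0 :: c0 is "\<lambda>_. 0" by simp

lift_definition plus_c0 :: "c0 \<Rightarrow> c0 \<Rightarrow> c0" is "\<lambda>z w j. z j + w j"
  using tendsto_add by fastforce

lift_definition minus_c0 :: "c0 \<Rightarrow> c0 \<Rightarrow> c0" is "\<lambda>z w j. z j - w j"
  using tendsto_diff by fastforce

lift_definition uminus_c0 :: "c0 \<Rightarrow> c0" is "\<lambda>z j. - z j"
  using tendsto_minus by fastforce

lift_definition scaleR_c0 :: "real \<Rightarrow> c0 \<Rightarrow> c0" is "\<lambda>r z j. r *\<^sub>R z j"
  using tendsto_scaleR[OF tendsto_const] by fastforce

definition norm_c0 :: "c0 \<Rightarrow> real"
  where "norm_c0 z = (SUP j. cmod (coord z j))"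

definition sgn_c0 :: "c0 \<Rightarrow> c0"
  where "sgn_c0 z = inverse (norm z) *\<^sub>R z"

definition dist_c0 :: "c0 \<Rightarrow> c0 \<Rightarrow> real"
  where "dist_c0 z w = norm (z - w)"

definition uniformity_c0 :: "(c0 \<times> c0) filter"
  where "uniformity_c0 = (INF e\<in>{0<..}. principal {(z, w). dist z w < e})"

definition open_c0 :: "c0 set \<Rightarrow> bool"
  where "open_c0 U \<longleftrightarrow> (\<forall>z\<in>U. eventually (\<lambda>(z', w). z' = z \<longrightarrow> w \<in> U) uniformity)"

lemma cmod_coord_le_norm: "cmod (coord z j) \<le> norm z"
  unfolding norm_c0_def by (rule cSUP_upper[OF UNIV_I bdd_above_coord])

lemma norm_c0_leI: "(\<And>j. cmod (coord z j) \<le> B) \<Longrightarrow> norm z \<le> B"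
  unfolding norm_c0_def by (rule cSUP_least) auto

instance
proof
  fix x y z :: c0 and a b :: real
  show "x + y + z = x + (y + z)" by transfer (simp add: add.assoc)
  show "x + y = y + x" by transfer (simp add: add.commute)
  show "0 + x = x" by transfer simp
  show "- x + x = 0" by transfer simp
  show "x - y = x + - y" by transfer simp
  show "a *\<^sub>R (x + y) = a *\<^sub>R x + a *\<^sub>R y" by transfer (simp add: scaleR_add_right)
  show "(a + b) *\<^sub>R x = a *\<^sub>R x + b *\<^sub>R x" by transfer (simp add: scaleR_add_left)
  show "a *\<^sub>R b *\<^sub>R x = (a * b) *\<^sub>R x" by transfer simp
  show "1 *\<^sub>R x = x" by transfer simp
  show "dist x y = norm (x - y)" by (simp add: dist_c0_def)
  show "sgn x = inverse (norm x) *\<^sub>R x" by (simp add: sgn_c0_def)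
  show "(uniformity :: (c0 \<times> c0) filter) = (INF e\<in>{0<..}. principal {(z, w). dist z w < e})"
    by (rule uniformity_c0_def)
  show "open U \<longleftrightarrow> (\<forall>z\<in>U. eventually (\<lambda>(z', w). z' = z \<longrightarrow> w \<in> U) uniformity)" for U :: "c0 set"
    by (rule open_c0_def)
  show "norm x = 0 \<longleftrightarrow> x = 0"
  proof
    assume "norm x = 0"
    then have "coord x j = 0" for j
      using cmod_coord_le_norm[of x j] by simp
    then show "x = 0" by transfer auto
  next
    assume "x = 0"
    then show "norm x = 0" by (simp add: norm_c0_def zero_c0.rep_eq)
  qed
  show "norm (x + y) \<le> norm x + norm y"
  proof (rule norm_c0_leI)
    fix j
    show "cmod (coord (x + y) j) \<le> norm x + norm y"
      using norm_triangle_ineq[of "coord x j" "coord y j"]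
        cmod_coord_le_norm[of x j] cmod_coord_le_norm[of y j]
      by (simp add: plus_c0.rep_eq)
  qed
  have le: "norm (a *\<^sub>R x) \<le> \<bar>a\<bar> * norm x" for a and x :: c0
    by (rule norm_c0_leI) (simp add: scaleR_c0.rep_eq mult_left_mono cmod_coord_le_norm)
  show "norm (a *\<^sub>R x) = \<bar>a\<bar> * norm x"
  proof (cases "a = 0")
    case True
    then show ?thesis by (simp add: norm_c0_def scaleR_c0.rep_eq)
  next
    case False
    have "inverse a *\<^sub>R (a *\<^sub>R x) = x" using False by transfer simp
    then have "norm x \<le> \<bar>inverse a\<bar> * norm (a *\<^sub>R x)"
      using le[of "inverse a" "a *\<^sub>R x"] by simp
    then have "\<bar>a\<bar> * norm x \<le> norm (a *\<^sub>R x)"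
      using False by (simp add: field_simps abs_inverse)
    then show ?thesis using le[of a x] by simp
  qed
qed

end

lift_definition scaleC_c0 :: "complex \<Rightarrow> c0 \<Rightarrow> c0" is "\<lambda>c z j. c * z j"
  using tendsto_mult[OF tendsto_const] by fastforce


definition modulus :: "(nat \<Rightarrow>\<^sub>0 nat) \<Rightarrow> nat"
  where "modulus m = (\<Sum>i\<in>Poly_Mapping.keys m. Poly_Mapping.lookup m i)"

text \<open>The shift by \<^const>\<open>Suc\<close> accounts for indexing from 0; the supremum of the empty set is 0.\<close>

definition len :: "(nat \<Rightarrow>\<^sub>0 nat) \<Rightarrow> nat"
  where "len m = Sup (Suc ` Poly_Mapping.keys m)"

definition monom_c0 :: "(nat \<Rightarrow>\<^sub>0 nat) \<Rightarrow> c0 \<Rightarrow> complex"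
  where "monom_c0 m z = (\<Prod>i\<in>Poly_Mapping.keys m. coord z i ^ Poly_Mapping.lookup m i)"

definition square_less :: "(nat \<Rightarrow>\<^sub>0 nat) \<Rightarrow> (nat \<Rightarrow>\<^sub>0 nat) \<Rightarrow> bool"
  where "square_less m m' \<longleftrightarrow> modulus m = modulus m' \<and>
    (len m < len m' \<or>
     len m = len m' \<and>
       (\<exists>s<len m. Poly_Mapping.lookup m s < Poly_Mapping.lookup m' s \<and> (\<forall>t>s. Poly_Mapping.lookup m t = Poly_Mapping.lookup m' t)))"

text \<open>
  An arrangement of the monomials is given by the enumeration \<open>e\<close> of their exponents; distinct
  exponents have distinct monomials.  Only exponents of equal modulus are related by
  \<^const>\<open>square_less\<close>.
\<close>

definition compatible_order :: "(nat \<Rightarrow> (nat \<Rightarrow>\<^sub>0 nat)) \<Rightarrow> bool"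
  where "compatible_order e \<longleftrightarrow> bij e \<and> (\<forall>i j. square_less (e i) (e j) \<longrightarrow> i < j)"


text \<open>Holomorphic means continuous and holomorphic along every complex line.\<close>

definition entire_c0 :: "(c0 \<Rightarrow> complex) set"
  where "entire_c0 = {f. continuous_on UNIV f \<and>
    (\<forall>a b. (\<lambda>t. f (a + scaleC_c0 t b)) holomorphic_on UNIV)}"

definition entire_b_c0 :: "(c0 \<Rightarrow> complex) set"
  where "entire_b_c0 = {f \<in> entire_c0. \<forall>B. bounded B \<longrightarrow> bounded (f ` B)}"


definition seminorm_on :: "('a \<Rightarrow> complex) set \<Rightarrow> (('a \<Rightarrow> complex) \<Rightarrow> real) \<Rightarrow> bool"
  where "seminorm_on E p \<longleftrightarrow>
    (\<forall>f\<in>E. 0 \<le> p f) \<and>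
    (\<forall>f\<in>E. \<forall>c. p (\<lambda>z. c * f z) = cmod c * p f) \<and>
    (\<forall>f\<in>E. \<forall>g\<in>E. p (\<lambda>z. f z + g z) \<le> p f + p g)"

text \<open>
  The topology on a linear space \<open>E\<close> of functions generated by a nonempty set \<open>\<P>\<close> of semi-norms.
\<close>

definition seminorm_topology ::
    "('a \<Rightarrow> complex) set \<Rightarrow> (('a \<Rightarrow> complex) \<Rightarrow> real) set \<Rightarrow> ('a \<Rightarrow> complex) topology"
  where "seminorm_topology E \<P> = topology_generated_by
    {{g \<in> E. p (\<lambda>z. g z - f z) < \<epsilon>} | f p \<epsilon>. f \<in> E \<and> p \<in> \<P> \<and> 0 < \<epsilon>}"

text \<open>The supremum is taken in \<^typ>\<open>ennreal\<close> as \<open>f\<close> may be unbounded on \<open>V\<close>.\<close>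

definition ported :: "((c0 \<Rightarrow> complex) \<Rightarrow> real) \<Rightarrow> c0 set \<Rightarrow> bool"
  where "ported p K \<longleftrightarrow> (\<forall>V. open V \<and> K \<subseteq> V \<longrightarrow>
    (\<exists>C>0. \<forall>f\<in>entire_c0. ennreal (p f) \<le> ennreal C * (SUP z\<in>V. ennreal (cmod (f z)))))"

definition tau_omega :: "(c0 \<Rightarrow> complex) topology"
  where "tau_omega = seminorm_topology entire_c0
    {p. seminorm_on entire_c0 p \<and> (\<exists>K. compact K \<and> ported p K)}"

definition tau_b :: "(c0 \<Rightarrow> complex) topology"
  where "tau_b = seminorm_topology entire_b_c0
    {\<lambda>f. SUP z\<in>B. cmod (f z) | B. bounded B \<and> B \<noteq> {}}"

definition schauder_basis :: "('a \<Rightarrow> complex) topology \<Rightarrow> (nat \<Rightarrow> 'a \<Rightarrow> complex) \<Rightarrow> bool"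
  where "schauder_basis T f \<longleftrightarrow> range f \<subseteq> topspace T \<and>
    (\<forall>x\<in>topspace T. \<exists>!c :: nat \<Rightarrow> complex.
       limitin T (\<lambda>N z. \<Sum>k<N. c k * f k z) x sequentially)"

lemma topspace_seminorm_topology:
  assumes "p \<in> \<P>" "\<And>f. f \<in> E \<Longrightarrow> p (\<lambda>z. f z - f z) = 0"
  shows "topspace (seminorm_topology E \<P>) = E"
proof -
  have "f \<in> topspace (seminorm_topology E \<P>)" if "f \<in> E" for f
    unfolding seminorm_topology_def topology_generated_by_topspace
    using that assms
    by (intro UnionI[of "{g \<in> E. p (\<lambda>z. g z - f z) < 1}"] CollectI exI[of _ f] exI[of _ p] exI[of _ "1::real"]) auto
  moreover have "topspace (seminorm_topology E \<P>) \<subseteq> E"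
    unfolding seminorm_topology_def topology_generated_by_topspace by blast
  ultimately show ?thesis by blast
qed

lemma topspace_tau_omega: "topspace tau_omega = entire_c0"
  unfolding tau_omega_def
proof (rule topspace_seminorm_topology)
  show "(\<lambda>_. 0) \<in> {p. seminorm_on entire_c0 p \<and> (\<exists>K. compact K \<and> ported p K)}"
    by (auto simp: seminorm_on_def ported_def intro!: exI[of _ "{}"] exI[of _ "1::real"])
qed simp

lemma topspace_tau_b: "topspace tau_b = entire_b_c0"
  unfolding tau_b_def
proof (rule topspace_seminorm_topology)
  show "(\<lambda>f. SUP z\<in>{0}. cmod (f z)) \<in> {\<lambda>f. SUP z\<in>B. cmod (f z) | B. bounded B \<and> B \<noteq> {}}"
    by blast
qed simp

end

theory Submission imports Defs begin

text \<open>
  The proof rests on two estimates for an \<open>n\<close>-homogeneous polynomial on the space of null sequences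
  and its supremum over a polydisc $\{z : |z_j| \le r_j\}$.

  First, a partial sum of its monomial expansion in the square order has supremum at most $n + 1$
  times that of the polynomial (\<open>initial_segment_bound\<close>).  Prescribing the exponents of some
  variables is an average over rotations, hence a contraction, and an initial segment of the
  square order, which within one degree is colexicographic, is a disjoint union of at most $n + 1$
  sets cut out by such prescriptions.  So the polydisc need not be changed, and the same
  bound serves all polyradii.

  Second, the polynomial is the uniform limit of its truncations to finitely many variables
  (\<open>homogeneous_truncations_uniformly_Cauchy\<close>), by a gliding hump argument and induction on the
  degree.  Together with the first estimate this gives uniform convergence of its expansion.

  Now let \<open>f\<close> be entire and bounded on the polydisc of polyradius $4 r$.  On the one of
  polyradius \<open>r\<close> its homogeneous parts are $O(4^{-n})$, and a compatible order restricts to the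
  square order in each degree.  A factor $n + 1$ is harmless here, so the expansion converges to
  \<open>f\<close> uniformly on that polydisc (\<open>monomial_expansion_uniform\<close>).

  For the bounded sets one takes constant polyradii.  For the ported topology, a compact set \<open>K\<close> is
  contained in a polydisc whose polyradius \<open>\<beta>\<close> is a null sequence.  The polydisc of polyradius
  $4 \beta$ is compact, so \<open>f\<close> is bounded on a polydisc of polyradius $4 (\beta + \delta)$
  with $\delta > 0$, and the expansion converges uniformly on a neighbourhood of \<open>K\<close>; this is what
  a semi-norm ported by \<open>K\<close> sees.  The coefficients are unique because both topologies are finer than
  uniform convergence on finite-dimensional polydiscs, which determines them by Cauchy's estimate.
\<close>

section \<open>Monomials and exponents\<close>

abbreviation expo :: "(nat \<Rightarrow>\<^sub>0 nat) \<Rightarrow> nat \<Rightarrow> nat" where "expo \<equiv> Poly_Mapping.lookup"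

text \<open>The monomial $w^m$ on all complex sequences, not only on null sequences.\<close>

definition mon :: "(nat \<Rightarrow>\<^sub>0 nat) \<Rightarrow> (nat \<Rightarrow> complex) \<Rightarrow> complex"
  where "mon m w = (\<Prod>i\<in>Poly_Mapping.keys m. w i ^ expo m i)"

text \<open>
  The closed polydisc of polyradius \<open>r\<close>, again in the space of all sequences; it is empty unless
  \<open>r\<close> is nonnegative.
\<close>

definition polydisc :: "(nat \<Rightarrow> real) \<Rightarrow> (nat \<Rightarrow> complex) set"
  where "polydisc r = {w. \<forall>j. cmod (w j) \<le> r j}"

text \<open>The exponents of modulus \<open>n\<close> supported in \<open>I\<close>.\<close>

definition exponents :: "nat \<Rightarrow> nat set \<Rightarrow> (nat \<Rightarrow>\<^sub>0 nat) set"
  where "exponents n I = {m. Poly_Mapping.keys m \<subseteq> I \<and> modulus m = n}"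

text \<open>The sum of the terms $c_m w^m$ over a set \<open>A\<close> of exponents, which is finite in all uses.\<close>

definition msum :: "((nat \<Rightarrow>\<^sub>0 nat) \<Rightarrow> complex) \<Rightarrow> (nat \<Rightarrow>\<^sub>0 nat) set \<Rightarrow> (nat \<Rightarrow> complex) \<Rightarrow> complex"
  where "msum c A w = (\<Sum>m\<in>A. c m * mon m w)"

lemma monom_c0_eq: "monom_c0 m z = mon m (coord z)"
  by (simp add: monom_c0_def mon_def)

lemma mon_eq_prod:
  assumes "finite I" "Poly_Mapping.keys m \<subseteq> I"
  shows "mon m w = (\<Prod>i\<in>I. w i ^ expo m i)"
  unfolding mon_def using assms
  by (intro prod.mono_neutral_left) (auto simp: in_keys_iff)

lemma modulus_eq_sum:
  assumes "finite I" "Poly_Mapping.keys m \<subseteq> I"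
  shows "modulus m = (\<Sum>i\<in>I. expo m i)"
  unfolding modulus_def using assms
  by (intro sum.mono_neutral_left) (auto simp: in_keys_iff)

lemma mon_cong: "(\<And>i. i \<in> Poly_Mapping.keys m \<Longrightarrow> w i = w' i) \<Longrightarrow> mon m w = mon m w'"
  unfolding mon_def by (rule prod.cong) auto

lemma mon_restrict:
  "mon m (\<lambda>i. if i \<in> I then w i else 0) = (if Poly_Mapping.keys m \<subseteq> I then mon m w else 0)"
proof (cases "Poly_Mapping.keys m \<subseteq> I")
  case True
  then show ?thesis by (auto intro!: mon_cong)
next
  case False
  then obtain i where "i \<in> Poly_Mapping.keys m" "i \<notin> I" by blast
  then have "(\<Prod>i\<in>Poly_Mapping.keys m. (if i \<in> I then w i else 0) ^ expo m i) = 0"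
    by (intro prod_zero) (auto simp: in_keys_iff)
  then show ?thesis using False by (simp add: mon_def)
qed

lemma mon_scale: "mon m (\<lambda>i. t * w i) = t ^ modulus m * mon m w"
  by (simp add: mon_def modulus_def power_mult_distrib prod.distrib power_sum)

lemma mon_scale_on:
  assumes "finite J"
  shows "mon m (\<lambda>i. if i \<in> J then t * w i else w i) = t ^ (\<Sum>i\<in>J. expo m i) * mon m w"
proof -
  define I where "I = J \<union> Poly_Mapping.keys m"
  have fin: "finite I" and sub: "Poly_Mapping.keys m \<subseteq> I" "J \<subseteq> I" using assms by (auto simp: I_def)
  have "mon m (\<lambda>i. if i \<in> J then t * w i else w i)
      = (\<Prod>i\<in>I. (if i \<in> J then t ^ expo m i else 1) * w i ^ expo m i)"
    by (subst mon_eq_prod[OF fin sub(1)]) (auto intro!: prod.cong simp: power_mult_distrib)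
  also have "\<dots> = (\<Prod>i\<in>I. if i \<in> J then t ^ expo m i else 1) * mon m w"
    by (simp add: prod.distrib mon_eq_prod[OF fin sub(1)])
  also have "(\<Prod>i\<in>I. if i \<in> J then t ^ expo m i else 1) = (\<Prod>i\<in>J. t ^ expo m i)"
    using fin sub(2) by (simp add: prod.If_cases Int_absorb1)
  finally show ?thesis by (simp add: power_sum)
qed

lemma mon_add: "mon (m + m') w = mon m w * mon m' w"
proof -
  define I where "I = Poly_Mapping.keys m \<union> Poly_Mapping.keys m'"
  have I: "finite I" "Poly_Mapping.keys m \<subseteq> I" "Poly_Mapping.keys m' \<subseteq> I"
    "Poly_Mapping.keys (m + m') \<subseteq> I"
    using Poly_Mapping.keys_add[of m m'] by (auto simp: I_def)
  show ?thesis
    by (simp add: mon_eq_prod[OF I(1) I(2)] mon_eq_prod[OF I(1) I(3)] mon_eq_prod[OF I(1) I(4)]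
        lookup_add power_add prod.distrib)
qed

lemma modulus_add: "modulus (m + m') = modulus m + modulus m'"
proof -
  define I where "I = Poly_Mapping.keys m \<union> Poly_Mapping.keys m'"
  have I: "finite I" "Poly_Mapping.keys m \<subseteq> I" "Poly_Mapping.keys m' \<subseteq> I"
    "Poly_Mapping.keys (m + m') \<subseteq> I"
    using Poly_Mapping.keys_add[of m m'] by (auto simp: I_def)
  show ?thesis
    by (simp add: modulus_eq_sum[OF I(1) I(2)] modulus_eq_sum[OF I(1) I(3)]
        modulus_eq_sum[OF I(1) I(4)] lookup_add sum.distrib)
qed

lemma mon_single: "mon (Poly_Mapping.single k v) w = w k ^ v"
  by (simp add: mon_def)

lemma modulus_single: "modulus (Poly_Mapping.single k v) = v"
  by (simp add: modulus_def)

lemma modulus_eq_0_iff: "modulus m = 0 \<longleftrightarrow> m = 0"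
  by (auto simp: modulus_def in_keys_iff intro: poly_mapping_eqI)

lemma mon_0 [simp]: "mon 0 w = 1"
  by (simp add: mon_def)

lemma expo_le_modulus: "expo m i \<le> modulus m"
proof (cases "i \<in> Poly_Mapping.keys m")
  case True
  then show ?thesis unfolding modulus_def by (intro member_le_sum) auto
qed (simp add: in_keys_iff)

lemma finite_exponents:
  assumes "finite I"
  shows "finite (exponents n I)"
proof -
  have "expo ` exponents n I \<subseteq> {f. \<forall>x. (x \<in> I \<longrightarrow> f x \<in> {..n}) \<and> (x \<notin> I \<longrightarrow> f x = 0)}"
    using expo_le_modulus by (auto simp: exponents_def in_keys_iff)
  then have "finite (expo ` exponents n I)"
    by (rule finite_subset) (intro finite_set_of_finite_funs assms finite_atMost)
  then show ?thesis
    by (rule finite_imageD) (auto intro!: inj_onI poly_mapping_eqI)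
qed

lemma exponents_0: "exponents 0 I = {0}"
  by (auto simp: exponents_def modulus_eq_0_iff)

lemma exponents_empty: "n > 0 \<Longrightarrow> exponents n {} = {}"
  by (auto simp: exponents_def modulus_def)

lemma exponents_mono: "I \<subseteq> J \<Longrightarrow> exponents n I \<subseteq> exponents n J"
  by (auto simp: exponents_def)

lemma msum_union_disjoint:
  "finite A \<Longrightarrow> finite B \<Longrightarrow> A \<inter> B = {} \<Longrightarrow> msum c (A \<union> B) w = msum c A w + msum c B w"
  unfolding msum_def by (rule sum.union_disjoint)

lemma msum_diff: "finite B \<Longrightarrow> A \<subseteq> B \<Longrightarrow> msum c (B - A) w = msum c B w - msum c A w"
  unfolding msum_def by (rule sum_diff)

lemma msum_empty [simp]: "msum c {} w = 0"
  by (simp add: msum_def)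

lemma msum_restrict_arg:
  assumes "finite A"
  shows "msum c A (\<lambda>i. if i \<in> I then w i else 0) = msum c {m\<in>A. Poly_Mapping.keys m \<subseteq> I} w"
  by (simp add: msum_def mon_restrict sum.inter_filter assms if_distrib cong: if_cong)

lemma polydisc_scale:
  "w \<in> polydisc r \<Longrightarrow> cmod t \<le> 1 \<Longrightarrow> (\<lambda>i. if P i then t * w i else w i) \<in> polydisc r"
  by (auto simp: polydisc_def norm_mult intro: order_trans[OF mult_right_mono[of "cmod t" 1]])

lemma polydisc_restrict:
  "w \<in> polydisc r \<Longrightarrow> (\<lambda>i. if P i then w i else 0) \<in> polydisc r"
  by (auto simp: polydisc_def intro: order_trans[OF norm_ge_zero])

section \<open>Averages over roots of unity\<close>

text \<open>A primitive \<open>n\<close>-th root of unity, for \<open>n > 0\<close>.\<close>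

definition unity_root :: "nat \<Rightarrow> complex"
  where "unity_root n = cis (2 * pi / real n)"

lemma cmod_unity_root_power [simp]: "cmod (unity_root n ^ j) = 1"
  by (simp add: unity_root_def norm_power)

lemma unity_root_nonzero [simp]: "unity_root n \<noteq> 0"
  by (simp add: unity_root_def)

lemma sum_unity_root_powi:
  assumes "n > 0"
  shows "(\<Sum>j<n. (unity_root n ^ j) powi k) = (if int n dvd k then of_nat n else 0)"
proof -
  define x where "x = unity_root n powi k"
  have x: "(unity_root n ^ j) powi k = x ^ j" for j
    by (simp add: x_def power_int_mult[symmetric] mult.commute flip: power_int_of_nat)
  have u: "unity_root n powi int n = 1"
    using assms Complex.DeMoivre[of "2 * pi / real n" n] by (simp add: unity_root_def)
  have "x ^ n = unity_root n powi (k * int n)"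
    by (simp add: x_def power_int_mult)
  then have xn: "x ^ n = 1"
    using u by (simp add: power_int_mult mult.commute[of k])
  have "x = 1 \<longleftrightarrow> int n dvd k"
  proof
    assume "int n dvd k"
    then obtain l where "k = int n * l" by blast
    then show "x = 1" using u by (simp add: x_def power_int_mult del: power_int_of_nat)
  next
    assume "x = 1"
    then have "cis (of_int k * (2 * pi / real n)) = 1" by (simp add: x_def unity_root_def cis_power_int)
    then have "cos (of_int k * (2 * pi / real n)) = 1" by (metis cis.sel(1) one_complex.sel(1))
    then obtain l :: int where "of_int k * (2 * pi / real n) = of_int l * 2 * pi"
      using cos_one_2pi_int by blast
    then have "of_int k = of_int l * real n" using assms by (simp add: field_simps)
    then have "k = l * int n" by (metis of_int_eq_iff of_int_mult of_int_of_nat_eq)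
    then show "int n dvd k" by simp
  qed
  then show ?thesis using xn by (simp add: x sum_gp_strict)
qed

lemma int_dvd_diff_iff_eq:
  assumes "a < N" "b < N"
  shows "int N dvd int b - int a \<longleftrightarrow> b = a"
proof
  assume "int N dvd int b - int a"
  moreover have "\<bar>int b - int a\<bar> < int N" using assms by linarith
  ultimately have "int b - int a = 0"
    by (metis abs_dvd_iff dvd_abs_iff zero_less_abs_iff zdvd_not_zless)
  then show "b = a" by simp
qed simp

lemma sum_unity_root_select:
  assumes "a < N" "b < N"
  shows "(\<Sum>j<N. (unity_root N ^ j) powi (- int a) * (unity_root N ^ j) ^ b) = (if b = a then of_nat N else 0)"
proof -
  have "(\<Sum>j<N. (unity_root N ^ j) powi (- int a) * (unity_root N ^ j) ^ b)
      = (\<Sum>j<N. (unity_root N ^ j) powi (int b - int a))"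
    by (intro sum.cong refl) (simp add: power_int_diff power_int_minus field_simps)
  also have "\<dots> = (if int N dvd int b - int a then of_nat N else 0)"
    using assms by (intro sum_unity_root_powi) simp
  also have "int N dvd int b - int a \<longleftrightarrow> b = a"
    by (rule int_dvd_diff_iff_eq[OF assms])
  finally show ?thesis .
qed

lemma norm_average_le:
  fixes g :: "nat \<Rightarrow> complex"
  assumes "n > 0" "\<And>j. j < n \<Longrightarrow> cmod (g j) \<le> B"
  shows "cmod ((\<Sum>j<n. g j) / of_nat n) \<le> B"
proof -
  have "cmod (\<Sum>j<n. g j) \<le> of_nat n * B"
    using sum_norm_bound[of "{..<n}" g B] assms by simp
  then show ?thesis using assms(1) by (simp add: norm_divide field_simps)
qed

section \<open>Partial sums of homogeneous polynomials\<close>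

text \<open>
  Prescribing one exponent is a contraction for the supremum over a polydisc, since it is an average
  over rotations of that coordinate.  No structure of the set \<open>X\<close> of exponents is needed.
\<close>

lemma msum_slice_bound:
  assumes fin: "finite X" and bd: "\<And>w. w \<in> polydisc r \<Longrightarrow> cmod (msum c X w) \<le> B"
    and w: "w \<in> polydisc r"
  shows "cmod (msum c {m\<in>X. expo m s = a} w) \<le> B"
proof -
  \<comment> \<open>larger than \<open>a\<close> and all the exponents that occur, so that congruence modulo \<open>N\<close> is equality\<close>
  define N where "N = Suc (a + (\<Sum>m\<in>X. expo m s))"
  have N: "N > 0" and aN: "a < N" by (simp_all add: N_def)
  have lt: "expo m s < N" if "m \<in> X" for m
    using member_le_sum[of m X "\<lambda>m. expo m s"] that fin by (auto simp: N_def)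
  define u where "u = unity_root N"
  define W where "W j = (\<lambda>i. if i \<in> {s} then u ^ j * w i else w i)" for j
  have W: "W j \<in> polydisc r" for j
    unfolding W_def by (rule polydisc_scale[OF w]) (simp add: u_def)
  have root: "(\<Sum>j<N. (u ^ j) powi (- int a) * (u ^ j) ^ expo m s) = (if expo m s = a then of_nat N else 0)"
    if "m \<in> X" for m
    unfolding u_def by (rule sum_unity_root_select[OF aN lt[OF that]])
  have "(\<Sum>j<N. (u ^ j) powi (- int a) * msum c X (W j))
      = (\<Sum>m\<in>X. \<Sum>j<N. (u ^ j) powi (- int a) * (c m * mon m (W j)))"
    unfolding msum_def by (simp only: sum_distrib_left) (rule sum.swap)
  also have "\<dots> = (\<Sum>m\<in>X. (c m * mon m w) * (\<Sum>j<N. (u ^ j) powi (- int a) * (u ^ j) ^ expo m s))"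
    unfolding W_def by (simp only: mon_scale_on[OF finite.insertI[OF finite.emptyI]])
      (simp add: sum_distrib_left mult_ac)
  also have "\<dots> = of_nat N * msum c {m\<in>X. expo m s = a} w"
    unfolding msum_def using fin
    by (simp add: root sum_distrib_left sum.inter_filter mult_ac if_distrib cong: if_cong)
  finally have eq: "msum c {m\<in>X. expo m s = a} w
      = (\<Sum>j<N. (u ^ j) powi (- int a) * msum c X (W j)) / of_nat N"
    using N by simp
  show ?thesis unfolding eq
    by (rule norm_average_le[OF N]) (simp add: norm_mult norm_power_int u_def bd[OF W])
qed

text \<open>Cauchy's estimate: prescribe all the exponents, one coordinate after the other.\<close>

lemma coefficient_bound:
  assumes fin: "finite X" and bd: "\<And>w. w \<in> polydisc r \<Longrightarrow> cmod (msum c X w) \<le> B"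
    and w: "w \<in> polydisc r" and m: "m \<in> X"
  shows "cmod (c m * mon m w) \<le> B"
proof -
  have slices: "cmod (msum c {m'\<in>X. \<forall>s<k. expo m' s = expo m s} w) \<le> B" if "w \<in> polydisc r" for k w
    using that
  proof (induction k arbitrary: w)
    case 0
    then show ?case using bd by simp
  next
    case (Suc k)
    have "{m'\<in>X. \<forall>s<Suc k. expo m' s = expo m s}
        = {m' \<in> {m'\<in>X. \<forall>s<k. expo m' s = expo m s}. expo m' k = expo m k}"
      by (auto simp: less_Suc_eq)
    then show ?case
      using msum_slice_bound[of "{m'\<in>X. \<forall>s<k. expo m' s = expo m s}" r c B w k "expo m k"] Suc fin
      by simp
  qed
  have "finite (\<Union>m'\<in>X. Poly_Mapping.keys m')" using fin by simp
  then obtain L where L: "\<forall>i\<in>(\<Union>m'\<in>X. Poly_Mapping.keys m'). i < L"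
    unfolding finite_nat_set_iff_bounded by blast
  have "m' = m" if "m' \<in> X" "\<forall>s<L. expo m' s = expo m s" for m'
  proof (rule poly_mapping_eqI)
    fix i
    show "expo m' i = expo m i"
    proof (cases "i < L")
      case False
      then have "i \<notin> Poly_Mapping.keys m'" "i \<notin> Poly_Mapping.keys m" using L that(1) m by blast+
      then show ?thesis by (simp add: in_keys_iff)
    qed (use that in auto)
  qed
  then have "{m'\<in>X. \<forall>s<L. expo m' s = expo m s} = {m}" using m by auto
  then show ?thesis using slices[OF w, of L] by (simp add: msum_def)
qed

text \<open>
  The colexicographic order, decided by the highest coordinate at which the exponents differ.  Among
  exponents of equal modulus it is contained in the square order, as the length is determined by the
  highest nonzero coordinate.
\<close>

definition colex :: "(nat \<Rightarrow>\<^sub>0 nat) \<Rightarrow> (nat \<Rightarrow>\<^sub>0 nat) \<Rightarrow> bool"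
  where "colex m m' \<longleftrightarrow> (\<exists>s. expo m s < expo m' s \<and> (\<forall>t>s. expo m t = expo m' t))"

lemma len_eq: "len m = (if m = 0 then 0 else Suc (Max (Poly_Mapping.keys m)))"
proof (cases "m = 0")
  case False
  then show ?thesis
    by (simp add: len_def Sup_nat_def mono_Max_commute[symmetric] mono_Suc)
qed (simp add: len_def Sup_nat_def)

lemma less_len: "i \<in> Poly_Mapping.keys m \<Longrightarrow> i < len m"
  by (auto simp: len_eq less_Suc_eq_le)

lemma len_le: "(\<And>i. i \<in> Poly_Mapping.keys m \<Longrightarrow> i < L) \<Longrightarrow> len m \<le> L"
  by (auto simp: len_eq Suc_le_eq)

lemma colex_imp_square_less:
  assumes "modulus m = modulus m'" "colex m m'"
  shows "square_less m m'"
proof -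
  obtain s where s: "expo m s < expo m' s" "\<forall>t>s. expo m t = expo m' t"
    using assms(2) by (auto simp: colex_def)
  have s': "s < len m'" using s(1) by (intro less_len) (auto simp: in_keys_iff)
  have "len m \<le> len m'"
  proof (rule len_le)
    fix i assume "i \<in> Poly_Mapping.keys m"
    then show "i < len m'" using s s' less_len[of i m']
      by (cases "i \<le> s") (auto simp: in_keys_iff)
  qed
  then show ?thesis using s s' assms(1) by (auto simp: square_less_def le_less)
qed

text \<open>
  The key estimate: taking an initial segment of a homogeneous polynomial multiplies its supremum
  over a polydisc by at most \<open>d + 1\<close>, where \<open>d\<close> is the degree.  For the induction on the number \<open>L\<close> of
  free coordinates, the exponents of the others are prescribed and do not count in \<open>d\<close>.  Let \<open>a\<close> be the largest exponent of the last free
  coordinate in \<open>A\<close>.  The \<open>a\<close> slices with smaller exponent lie entirely in \<open>A\<close> and cost one contraction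
  each; in the slice with exponent \<open>a\<close> the degree that remains is \<open>d - a\<close>.
\<close>

lemma initial_segment_bound:
  assumes "finite X" "A \<subseteq> X"
    and "\<And>m m' i. m \<in> X \<Longrightarrow> m' \<in> X \<Longrightarrow> i \<ge> L \<Longrightarrow> expo m i = expo m' i"
    and "\<And>m. m \<in> X \<Longrightarrow> (\<Sum>i<L. expo m i) = d"
    and "\<And>m m'. m \<in> A \<Longrightarrow> m' \<in> X \<Longrightarrow> colex m' m \<Longrightarrow> m' \<in> A"
    and "\<And>w. w \<in> polydisc r \<Longrightarrow> cmod (msum c X w) \<le> B"
    and "w \<in> polydisc r"
  shows "cmod (msum c A w) \<le> real (d + 1) * B"
  using assms
proof (induction L arbitrary: X A d)
  case 0
  have B: "0 \<le> B" using 0(6)[OF 0(7)] norm_ge_zero order_trans by blast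
  have "m = m'" if "m \<in> X" "m' \<in> X" for m m'
    using 0(3)[OF that] by (auto intro: poly_mapping_eqI)
  then have "A = {} \<or> A = X" using 0(2) by blast
  moreover have "B \<le> real (d + 1) * B" using B by (simp add: algebra_simps)
  ultimately show ?case using B 0(6)[OF 0(7)] by auto
next
  case (Suc L)
  have B: "0 \<le> B" using Suc(7)[OF Suc(8)] norm_ge_zero order_trans by blast
  have finA: "finite A" using Suc(2,3) finite_subset by blast
  show ?case
  proof (cases "A = {}")
    case True
    then show ?thesis using B by simp
  next
    case False
    define a where "a = Max ((\<lambda>m. expo m L) ` A)"
    have a_ge: "expo m L \<le> a" if "m \<in> A" for m
      unfolding a_def using that finA by (intro Max_ge) auto
    have "a \<in> (\<lambda>m. expo m L) ` A"
      unfolding a_def using finA False by (intro Max_in) auto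
    then obtain m0 where m0: "m0 \<in> A" "expo m0 L = a" by auto
    define S where "S v = {m\<in>X. expo m L = v}" for v
    define T where "T = {m\<in>A. expo m L = a}"
    have finS: "finite (S v)" for v using Suc(2) by (simp add: S_def)
    have Sbd: "cmod (msum c (S v) w) \<le> B" if "w \<in> polydisc r" for v w
      unfolding S_def by (rule msum_slice_bound[OF Suc(2) Suc(7) that])
    have "m0 \<in> X" using m0 Suc(3) by blast
    then have ad: "a \<le> d" using Suc(5)[of m0] m0(2) by simp
    have Tbd: "cmod (msum c T w) \<le> real (d - a + 1) * B"
    proof (rule Suc.IH[of "S a"])
      show "expo m i = expo m' i" if "m \<in> S a" "m' \<in> S a" "L \<le> i" for m m' i
        using that Suc(4)[of m m' i] by (cases "i = L") (auto simp: S_def)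
      show "(\<Sum>i<L. expo m i) = d - a" if "m \<in> S a" for m
        using that Suc(5)[of m] by (auto simp: S_def)
      show "m' \<in> T" if "m \<in> T" "m' \<in> S a" "colex m' m" for m m'
        using that Suc(6)[of m m'] by (auto simp: S_def T_def)
    qed (use finS Sbd Suc(3,8) in \<open>auto simp: S_def T_def\<close>)
    have A: "A = (\<Union>v<a. S v) \<union> T"
    proof (intro equalityI subsetI)
      fix m assume "m \<in> A"
      then show "m \<in> (\<Union>v<a. S v) \<union> T" using a_ge[of m] Suc(3) by (auto simp: S_def T_def)
    next
      fix m assume "m \<in> (\<Union>v<a. S v) \<union> T"
      \<comment> \<open>slices with smaller exponent precede the element \<open>m0\<close> of \<open>A\<close>\<close>
      moreover have "m \<in> A" if "v < a" "m \<in> S v" for v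
      proof (rule Suc(6)[OF m0(1)])
        have "\<forall>t>L. expo m t = expo m0 t"
          using that(2) \<open>m0 \<in> X\<close> Suc(4)[of m m0] by (auto simp: S_def)
        then show "colex m m0"
          unfolding colex_def using that m0(2) by (intro exI[of _ L]) (auto simp: S_def)
      qed (use that in \<open>auto simp: S_def\<close>)
      ultimately show "m \<in> A" by (auto simp: T_def)
    qed
    have "msum c A w = msum c (\<Union>v<a. S v) w + msum c T w"
      unfolding A using finA finS by (intro msum_union_disjoint) (auto simp: S_def T_def)
    also have "msum c (\<Union>v<a. S v) w = (\<Sum>v<a. msum c (S v) w)"
      unfolding msum_def using finS by (intro sum.UNION_disjoint) (auto simp: S_def)
    finally have "cmod (msum c A w) \<le> cmod (\<Sum>v<a. msum c (S v) w) + cmod (msum c T w)"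
      by (simp add: norm_triangle_ineq)
    also have "cmod (\<Sum>v<a. msum c (S v) w) \<le> real a * B"
      using sum_norm_bound[of "{..<a}" "\<lambda>v. msum c (S v) w" B] Sbd[OF Suc(8)] by simp
    also note Tbd
    finally show ?thesis using ad by (simp add: algebra_simps of_nat_diff)
  qed
qed

section \<open>Uniform approximation of homogeneous polynomials by truncations\<close>

text \<open>Some rotation of \<open>b\<close> points in the direction of \<open>a\<close>, and every rotation has a \<open>d\<close>-th root.\<close>

lemma exists_aligning_root:
  fixes a b :: complex
  assumes "d > 0"
  obtains \<theta> where "cmod \<theta> = 1" "cmod (a + \<theta> ^ d * b) = cmod a + cmod b"
proof (cases "a = 0 \<or> b = 0")
  case True
  then show ?thesis by (intro that[of 1]) auto
next
  case False
  define q where "q = sgn a / sgn b"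
  have q: "cmod q = 1" using False by (simp add: q_def norm_divide norm_sgn)
  have "cis (Arg q / d) ^ d = cis (real d * (Arg q / d))" by (rule Complex.DeMoivre)
  also have "\<dots> = cis (Arg q)" using assms by simp
  also have "\<dots> = q" using cis_Arg[of q] q by (cases "q = 0") (auto simp: sgn_eq)
  finally have "a + cis (Arg q / d) ^ d * b = sgn a * of_real (cmod a + cmod b)"
    using False by (simp add: q_def sgn_eq distrib_left)
  then have "cmod (a + cis (Arg q / d) ^ d * b) = cmod a + cmod b"
    using False by (simp only: norm_mult norm_sgn norm_of_real) auto
  then show ?thesis by (intro that[of "cis (Arg q / d)"]) auto
qed

lemma exists_norm_ge_average:
  fixes g :: "nat \<Rightarrow> complex"
  assumes "n > 0"
  obtains j where "j < n" "cmod ((\<Sum>j<n. g j) / of_nat n) \<le> cmod (g j)"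
proof -
  have "Max ((\<lambda>j. cmod (g j)) ` {..<n}) \<in> (\<lambda>j. cmod (g j)) ` {..<n}"
    using assms by (intro Max_in) auto
  then obtain j where j: "j < n" "Max ((\<lambda>j. cmod (g j)) ` {..<n}) = cmod (g j)" by auto
  have "cmod ((\<Sum>j<n. g j) / of_nat n) \<le> cmod (g j)"
    by (rule norm_average_le[OF assms]) (unfold j(2)[symmetric], auto intro!: Max_ge)
  with j(1) show ?thesis by (rule that)
qed

text \<open>
  The values of a \<open>d\<close>-homogeneous polynomial \<open>P\<close> on disjoint blocks of coordinates add up: with
  \<open>w\<close> supported in \<open>I\<close> and \<open>z\<close> in \<open>J\<close>, the average of $P(w + \lambda z)$ over the numbers
  $\lambda = \theta \omega$, where $\omega^d = 1$, is $P(w) + \theta^d P(z)$, because only the terms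
  of degree $0$ and $d$ in $\lambda$ survive.
\<close>

lemma homogeneous_disjoint_blocks:
  assumes d: "d > 0" and fin: "finite I" "finite J" and disj: "I \<inter> J = {}"
    and w: "w \<in> polydisc r" and z: "z \<in> polydisc r"
  obtains w' where "w' \<in> polydisc r"
    "cmod (msum c (exponents d I) w) + cmod (msum c (exponents d J) z)
      \<le> cmod (msum c (exponents d (I \<union> J)) w')"
proof -
  define a where "a = msum c (exponents d I) w"
  define b where "b = msum c (exponents d J) z"
  obtain \<theta> where \<theta>: "cmod \<theta> = 1" "cmod (a + \<theta> ^ d * b) = cmod a + cmod b"
    using exists_aligning_root[OF d] by blast
  define u where "u = unity_root d"
  define v where "v i = (if i \<in> J then z i else w i)" for i
  define W where "W j = (\<lambda>i. if i \<in> J then (\<theta> * u ^ j) * v i else v i)" for j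
  have v: "v \<in> polydisc r" using w z by (auto simp: v_def polydisc_def)
  have W: "W j \<in> polydisc r" for j
    unfolding W_def by (rule polydisc_scale[OF v]) (simp add: norm_mult \<theta> u_def)
  let ?X = "exponents d (I \<union> J)"
  have finX: "finite ?X" using fin by (intro finite_exponents) simp
  define s where "s m = (\<Sum>i\<in>J. expo m i)" for m
  have s: "s m = 0 \<longleftrightarrow> Poly_Mapping.keys m \<subseteq> I" "s m = d \<longleftrightarrow> Poly_Mapping.keys m \<subseteq> J" "s m \<le> d"
    if "m \<in> ?X" for m
  proof -
    have k: "Poly_Mapping.keys m \<subseteq> I \<union> J" and "modulus m = d" using that by (auto simp: exponents_def)
    then have sum: "d = (\<Sum>i\<in>I. expo m i) + s m"
      using modulus_eq_sum[of "I \<union> J" m] fin disj by (simp add: s_def sum.union_disjoint)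
    then show "s m \<le> d" by simp
    have zero: "(\<Sum>i\<in>I'. expo m i) = 0 \<longleftrightarrow> Poly_Mapping.keys m \<inter> I' = {}" if "finite I'" for I'
      using that by (auto simp: in_keys_iff)
    have "Poly_Mapping.keys m \<inter> J = {} \<longleftrightarrow> Poly_Mapping.keys m \<subseteq> I"
      using k disj by blast
    then show "s m = 0 \<longleftrightarrow> Poly_Mapping.keys m \<subseteq> I"
      using zero[OF fin(2)] by (simp add: s_def)
    have "s m = d \<longleftrightarrow> (\<Sum>i\<in>I. expo m i) = 0" using sum by auto
    moreover have "Poly_Mapping.keys m \<inter> I = {} \<longleftrightarrow> Poly_Mapping.keys m \<subseteq> J"
      using k disj by blast
    ultimately show "s m = d \<longleftrightarrow> Poly_Mapping.keys m \<subseteq> J"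
      using zero[OF fin(1)] by simp
  qed
  have root: "(\<Sum>j<d. (\<theta> * u ^ j) ^ s m)
      = of_nat d * ((if Poly_Mapping.keys m \<subseteq> I then 1 else 0) + (if Poly_Mapping.keys m \<subseteq> J then \<theta> ^ d else 0))"
    if "m \<in> ?X" for m
  proof -
    have "(\<Sum>j<d. (\<theta> * u ^ j) ^ s m) = \<theta> ^ s m * (\<Sum>j<d. (u ^ j) powi int (s m))"
      by (simp add: power_mult_distrib sum_distrib_left)
    also have "\<dots> = (if d dvd s m then of_nat d * \<theta> ^ s m else 0)"
      unfolding u_def by (subst sum_unity_root_powi[OF d]) simp
    also have "d dvd s m \<longleftrightarrow> s m = 0 \<or> s m = d"
      using s(3)[OF that] d by (auto dest: dvd_imp_le)
    finally show ?thesis using s(1,2)[OF that] d by auto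
  qed
  have "(\<Sum>j<d. msum c ?X (W j)) = (\<Sum>m\<in>?X. \<Sum>j<d. c m * mon m (W j))"
    unfolding msum_def by (rule sum.swap)
  also have "\<dots> = (\<Sum>m\<in>?X. c m * mon m v * (\<Sum>j<d. (\<theta> * u ^ j) ^ s m))"
    unfolding W_def by (simp only: mon_scale_on[OF fin(2)]) (simp add: sum_distrib_left mult_ac s_def)
  also have "\<dots> = of_nat d * ((\<Sum>m\<in>?X. if Poly_Mapping.keys m \<subseteq> I then c m * mon m v else 0)
      + \<theta> ^ d * (\<Sum>m\<in>?X. if Poly_Mapping.keys m \<subseteq> J then c m * mon m v else 0))"
  proof -
    have "(\<Sum>m\<in>?X. c m * mon m v * (\<Sum>j<d. (\<theta> * u ^ j) ^ s m))
      = (\<Sum>m\<in>?X. of_nat d * ((if Poly_Mapping.keys m \<subseteq> I then c m * mon m v else 0)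
          + \<theta> ^ d * (if Poly_Mapping.keys m \<subseteq> J then c m * mon m v else 0)))"
      by (intro sum.cong refl, simp only: root) (simp add: algebra_simps)
    then show ?thesis by (simp only: sum_distrib_left[symmetric] sum.distrib)
  qed
  also have "(\<Sum>m\<in>?X. if Poly_Mapping.keys m \<subseteq> I then c m * mon m v else 0) = a"
    unfolding a_def msum_def sum.inter_filter[OF finX, symmetric]
  proof (intro sum.cong)
    show "c m * mon m v = c m * mon m w" if "m \<in> exponents d I" for m
    proof -
      have "mon m v = mon m w" using that disj by (intro mon_cong) (auto simp: exponents_def v_def)
      then show ?thesis by simp
    qed
  qed (auto simp: exponents_def)
  also have "(\<Sum>m\<in>?X. if Poly_Mapping.keys m \<subseteq> J then c m * mon m v else 0) = b"
    unfolding b_def msum_def sum.inter_filter[OF finX, symmetric]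
  proof (intro sum.cong)
    show "c m * mon m v = c m * mon m z" if "m \<in> exponents d J" for m
    proof -
      have "mon m v = mon m z" using that by (intro mon_cong) (auto simp: exponents_def v_def)
      then show ?thesis by simp
    qed
  qed (auto simp: exponents_def)
  finally have "(\<Sum>j<d. msum c ?X (W j)) / of_nat d = a + \<theta> ^ d * b" using d by simp
  then obtain j where "cmod (a + \<theta> ^ d * b) \<le> cmod (msum c ?X (W j))"
    using exists_norm_ge_average[OF d, of "\<lambda>j. msum c ?X (W j)"] by metis
  then show ?thesis using W[of j] \<theta>(2) by (intro that[of "W j"]) (auto simp: a_def b_def)
qed

text \<open>
  A gliding hump argument: otherwise infinitely many disjoint blocks carry values larger than
  \<open>\<epsilon>\<close>, and adding these up contradicts boundedness.
\<close>

lemma homogeneous_tail_small: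
  assumes d: "d > 0" and r: "\<And>j. 0 \<le> r j"
    and bd: "\<And>L w. w \<in> polydisc r \<Longrightarrow> cmod (msum c (exponents d {K..<L}) w) \<le> M"
    and \<epsilon>: "\<epsilon> > 0"
  obtains K' where "K' \<ge> K" "\<And>L w. w \<in> polydisc r \<Longrightarrow> cmod (msum c (exponents d {K'..<L}) w) \<le> \<epsilon>"
proof (rule ccontr)
  note found = that
  assume "\<not> thesis"
  then have big: "\<exists>L. \<exists>w\<in>polydisc r. \<epsilon> < cmod (msum c (exponents d {K'..<L}) w)" if K': "K' \<ge> K" for K'
    using found[OF K'] by (meson not_le)
  have grow: "\<exists>L\<ge>K. \<exists>w\<in>polydisc r. real k * \<epsilon> \<le> cmod (msum c (exponents d {K..<L}) w)" for k
  proof (induction k)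
    case 0
    have "(\<lambda>_. 0) \<in> polydisc r" using r by (simp add: polydisc_def)
    then show ?case by auto
  next
    case (Suc k)
    then obtain L w where L: "L \<ge> K" "w \<in> polydisc r"
      "real k * \<epsilon> \<le> cmod (msum c (exponents d {K..<L}) w)" by blast
    obtain L' z where L': "z \<in> polydisc r" "\<epsilon> < cmod (msum c (exponents d {L..<L'}) z)"
      using big[OF L(1)] by blast
    have "L < L'"
    proof (rule ccontr)
      assume "\<not> L < L'"
      then show False using L'(2) \<epsilon> exponents_empty[OF d] by simp
    qed
    obtain w' where w': "w' \<in> polydisc r"
      "cmod (msum c (exponents d {K..<L}) w) + cmod (msum c (exponents d {L..<L'}) z)
        \<le> cmod (msum c (exponents d ({K..<L} \<union> {L..<L'})) w')"
      using homogeneous_disjoint_blocks[OF d _ _ _ L(2) L'(1), of "{K..<L}" "{L..<L'}" c] by auto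
    have "{K..<L} \<union> {L..<L'} = {K..<L'}" using L(1) \<open>L < L'\<close> by auto
    then have "real (Suc k) * \<epsilon> \<le> cmod (msum c (exponents d {K..<L'}) w')"
      using w'(2) L(3) L'(2) by (simp add: algebra_simps)
    then show ?case using w'(1) L(1) \<open>L < L'\<close> by (intro exI[of _ L']) auto
  qed
  obtain k :: nat where "M < real k * \<epsilon>" using reals_Archimedean3[OF \<epsilon>] by blast
  then show False using grow[of k] bd by (meson le_less_trans not_le order_trans)
qed

lemma slice_eq_shift:
  assumes "K < L" "v \<le> d"
  shows "{m \<in> exponents d {K..<L}. expo m K = v}
    = (\<lambda>m. m + Poly_Mapping.single K v) ` exponents (d - v) {Suc K..<L}"
proof (intro equalityI subsetI)
  fix m assume m: "m \<in> {m \<in> exponents d {K..<L}. expo m K = v}"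
  define m' where "m' = m - Poly_Mapping.single K v"
  have eq: "m = m' + Poly_Mapping.single K v"
    by (rule poly_mapping_eqI) (use m in \<open>auto simp: m'_def lookup_add lookup_minus lookup_single when_def\<close>)
  have "expo m' i = 0" if "i \<notin> {Suc K..<L}" for i
  proof (cases "i = K")
    case False
    then have "i \<notin> {K..<L}" using that by auto
    then have "i \<notin> Poly_Mapping.keys m" using m by (auto simp: exponents_def)
    then show ?thesis by (simp add: m'_def lookup_minus in_keys_iff)
  qed (use m in \<open>simp add: m'_def lookup_minus\<close>)
  then have "Poly_Mapping.keys m' \<subseteq> {Suc K..<L}" by (metis in_keys_iff subsetI)
  moreover have "modulus m = modulus m' + v"
    by (subst eq) (simp only: modulus_add modulus_single)
  then have "modulus m' = d - v" using m by (auto simp: exponents_def)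
  ultimately show "m \<in> (\<lambda>m. m + Poly_Mapping.single K v) ` exponents (d - v) {Suc K..<L}"
    using eq by (auto simp: exponents_def)
next
  fix m assume "m \<in> (\<lambda>m. m + Poly_Mapping.single K v) ` exponents (d - v) {Suc K..<L}"
  then obtain m' where m': "m = m' + Poly_Mapping.single K v" "Poly_Mapping.keys m' \<subseteq> {Suc K..<L}"
    "modulus m' = d - v" by (auto simp: exponents_def)
  have "K \<notin> Poly_Mapping.keys m'" using m'(2) by auto
  then have "expo m K = v" by (simp add: m'(1) lookup_add in_keys_iff)
  moreover have "Poly_Mapping.keys m \<subseteq> {K..<L}"
  proof -
    have "Poly_Mapping.keys m \<subseteq> Poly_Mapping.keys m' \<union> Poly_Mapping.keys (Poly_Mapping.single K v)"
      unfolding m'(1) by (rule Poly_Mapping.keys_add)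
    also have "\<dots> \<subseteq> {Suc K..<L} \<union> {K}" using m'(2) by auto
    also have "\<dots> \<subseteq> {K..<L}" using assms(1) by auto
    finally show ?thesis .
  qed
  moreover have "modulus m = d" using m' assms(2) by (simp add: modulus_add modulus_single)
  ultimately show "m \<in> {m \<in> exponents d {K..<L}. expo m K = v}" by (simp add: exponents_def)
qed

lemma msum_slice_eq:
  assumes "K < L" "v \<le> d"
  shows "msum c {m \<in> exponents d {K..<L}. expo m K = v} w
    = w K ^ v * msum (\<lambda>m. c (m + Poly_Mapping.single K v)) (exponents (d - v) {Suc K..<L}) w"
proof -
  have "inj_on (\<lambda>m. m + Poly_Mapping.single K v) (exponents (d - v) {Suc K..<L})"
    by (auto intro: inj_onI)
  then show ?thesis
    unfolding slice_eq_shift[OF assms] msum_def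
    by (simp add: sum.reindex mon_add mon_single sum_distrib_left mult_ac)
qed

text \<open>Expansion of a homogeneous polynomial in powers of its first variable.\<close>

lemma msum_peel:
  assumes "K < L"
  shows "msum c (exponents d {K..<L}) w = msum c (exponents d {Suc K..<L}) w
    + (\<Sum>v=1..d. w K ^ v * msum (\<lambda>m. c (m + Poly_Mapping.single K v)) (exponents (d - v) {Suc K..<L}) w)"
proof -
  let ?X = "exponents d {K..<L}"
  have "msum c ?X w = (\<Sum>v\<in>{0..d}. msum c {m\<in>?X. expo m K = v} w)"
  proof -
    have "(\<lambda>m. expo m K) ` ?X \<subseteq> {0..d}" using expo_le_modulus by (auto simp: exponents_def)
    then show ?thesis
      unfolding msum_def by (intro sum.group[symmetric] finite_exponents) auto
  qed
  also have "\<dots> = (\<Sum>v=0..d. w K ^ v * msum (\<lambda>m. c (m + Poly_Mapping.single K v)) (exponents (d - v) {Suc K..<L}) w)"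
    by (intro sum.cong refl msum_slice_eq assms) auto
  also have "\<dots> = msum c (exponents d {Suc K..<L}) w
    + (\<Sum>v=1..d. w K ^ v * msum (\<lambda>m. c (m + Poly_Mapping.single K v)) (exponents (d - v) {Suc K..<L}) w)"
    by (simp add: sum.atLeast_Suc_atMost)
  finally show ?thesis .
qed

lemma uniformly_Cauchy_on_add:
  fixes f g :: "nat \<Rightarrow> 'a \<Rightarrow> 'b::real_normed_vector"
  assumes "uniformly_Cauchy_on X f" "uniformly_Cauchy_on X g"
  shows "uniformly_Cauchy_on X (\<lambda>n x. f n x + g n x)"
proof (rule uniformly_Cauchy_onI)
  fix e :: real assume "e > 0"
  then have "e / 2 > 0" by simp
  obtain M N where
    M: "\<And>x m n. x \<in> X \<Longrightarrow> m \<ge> M \<Longrightarrow> n \<ge> M \<Longrightarrow> dist (f m x) (f n x) < e / 2" and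
    N: "\<And>x m n. x \<in> X \<Longrightarrow> m \<ge> N \<Longrightarrow> n \<ge> N \<Longrightarrow> dist (g m x) (g n x) < e / 2"
    using assms \<open>e / 2 > 0\<close> unfolding uniformly_Cauchy_on_def by meson
  have "dist (f m x + g m x) (f n x + g n x) < e" if "x \<in> X" "m \<ge> max M N" "n \<ge> max M N" for x m n
    using dist_triangle_add[of "f m x" "g m x" "f n x" "g n x"] M[of x m n] N[of x m n] that by simp
  then show "\<exists>M. \<forall>x\<in>X. \<forall>m\<ge>M. \<forall>n\<ge>M. dist (f m x + g m x) (f n x + g n x) < e" by blast
qed

lemma uniformly_Cauchy_on_const: "uniformly_Cauchy_on X (\<lambda>_. f)"
  by (rule uniformly_Cauchy_onI) simp

lemma uniformly_Cauchy_on_sum: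
  fixes f :: "'i \<Rightarrow> nat \<Rightarrow> 'a \<Rightarrow> 'b::real_normed_vector"
  assumes "\<And>i. i \<in> I \<Longrightarrow> uniformly_Cauchy_on X (f i)"
  shows "uniformly_Cauchy_on X (\<lambda>n x. \<Sum>i\<in>I. f i n x)"
  using assms
  by (induction I rule: infinite_finite_induct)
    (auto intro: uniformly_Cauchy_on_add uniformly_Cauchy_on_const)

lemma uniformly_Cauchy_on_bounded_mult:
  fixes f :: "nat \<Rightarrow> 'a \<Rightarrow> complex"
  assumes "uniformly_Cauchy_on X f" "\<And>x. x \<in> X \<Longrightarrow> cmod (h x) \<le> B"
  shows "uniformly_Cauchy_on X (\<lambda>n x. h x * f n x)"
proof (rule uniformly_Cauchy_onI)
  fix e :: real assume e: "e > 0"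
  define B' where "B' = \<bar>B\<bar> + 1"
  have B': "B' > 0" "B \<le> B'" by (simp_all add: B'_def)
  obtain M where M: "\<And>x m n. x \<in> X \<Longrightarrow> m \<ge> M \<Longrightarrow> n \<ge> M \<Longrightarrow> dist (f m x) (f n x) < e / B'"
    using assms(1) e B' unfolding uniformly_Cauchy_on_def by (meson divide_pos_pos)
  have "dist (h x * f m x) (h x * f n x) < e" if "x \<in> X" "m \<ge> M" "n \<ge> M" for x m n
  proof -
    have "dist (h x * f m x) (h x * f n x) = cmod (h x) * dist (f m x) (f n x)"
      by (simp add: dist_norm norm_mult flip: right_diff_distrib)
    also have "\<dots> \<le> B' * dist (f m x) (f n x)"
      using assms(2)[OF that(1)] B' by (intro mult_right_mono) auto
    also have "\<dots> < e" using M[OF that] B' by (simp add: field_simps)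
    finally show ?thesis .
  qed
  then show "\<exists>M. \<forall>x\<in>X. \<forall>m\<ge>M. \<forall>n\<ge>M. dist (h x * f m x) (h x * f n x) < e" by blast
qed

lemma uniformly_Cauchy_on_eventually_cong:
  assumes "uniformly_Cauchy_on X f" "\<And>n x. n \<ge> N \<Longrightarrow> x \<in> X \<Longrightarrow> f n x = g n x"
  shows "uniformly_Cauchy_on X g"
proof (rule uniformly_Cauchy_onI)
  fix e :: real assume "e > 0"
  then obtain M where "\<forall>x\<in>X. \<forall>m\<ge>M. \<forall>n\<ge>M. dist (f m x) (f n x) < e"
    using assms(1) unfolding uniformly_Cauchy_on_def by meson
  then have "dist (g m x) (g n x) < e" if "x \<in> X" "m \<ge> max M N" "n \<ge> max M N" for x m n
    using assms(2)[of m x] assms(2)[of n x] that by (metis max.bounded_iff)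
  then show "\<exists>M. \<forall>x\<in>X. \<forall>m\<ge>M. \<forall>n\<ge>M. dist (g m x) (g n x) < e" by blast
qed

lemma shift_bounded:
  assumes r: "\<And>j. 0 < r j"
    and bd: "\<And>L w. w \<in> polydisc r \<Longrightarrow> cmod (msum c (exponents d {K..<L}) w) \<le> M"
    and v: "v \<le> d" and w: "w \<in> polydisc r"
  shows "cmod (msum (\<lambda>m. c (m + Poly_Mapping.single K v)) (exponents (d - v) {Suc K..<L}) w) \<le> M / r K ^ v"
proof -
  define c' where "c' = (\<lambda>m. c (m + Poly_Mapping.single K v))"
  define L' where "L' = max L (Suc K)"
  have L': "K < L'" "{Suc K..<L} = {Suc K..<L'}" by (auto simp: L'_def)
  \<comment> \<open>the largest value of the coordinate \<open>K\<close>, on which the shifted sum does not depend\<close>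
  define w1 where "w1 = w(K := of_real (r K))"
  have w1: "w1 \<in> polydisc r" using w less_imp_le[OF r] by (auto simp: polydisc_def w1_def)
  have eq: "msum c' (exponents (d - v) {Suc K..<L'}) w1 = msum c' (exponents (d - v) {Suc K..<L'}) w"
    unfolding msum_def
  proof (rule sum.cong[OF refl])
    fix m assume "m \<in> exponents (d - v) {Suc K..<L'}"
    then have "mon m w1 = mon m w" by (intro mon_cong) (auto simp: exponents_def w1_def)
    then show "c' m * mon m w1 = c' m * mon m w" by simp
  qed
  have "cmod (msum c {m \<in> exponents d {K..<L'}. expo m K = v} w1) \<le> M"
    by (rule msum_slice_bound[OF finite_exponents bd w1]) auto
  then have "r K ^ v * cmod (msum c' (exponents (d - v) {Suc K..<L'}) w) \<le> M"
    using less_imp_le[OF r[of K]]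
    by (simp add: msum_slice_eq[OF L'(1) v] c'_def[symmetric] eq norm_mult norm_power)
      (simp add: w1_def)
  then show ?thesis using r[of K] by (simp add: c'_def L'(2) field_simps)
qed

lemma bounded_tail:
  assumes bd: "\<And>L w. w \<in> polydisc r \<Longrightarrow> cmod (msum c (exponents d {K..<L}) w) \<le> M"
    and "K \<le> K'" "w \<in> polydisc r"
  shows "cmod (msum c (exponents d {K'..<L}) w) \<le> M"
proof -
  have "{m \<in> exponents d {K..<L}. Poly_Mapping.keys m \<subseteq> {K'..}} = exponents d {K'..<L}"
    using assms(2) by (fastforce simp: exponents_def)
  then have "msum c (exponents d {K'..<L}) w = msum c (exponents d {K..<L}) (\<lambda>i. if i \<in> {K'..} then w i else 0)"
    by (subst msum_restrict_arg) (simp_all add: finite_exponents)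
  then show ?thesis using bd[OF polydisc_restrict[OF assms(3)]] by simp
qed

text \<open>
  If the truncations of a homogeneous polynomial to finitely many variables are bounded on a polydisc,
  uniformly in their number, then they converge uniformly on it.  By the gliding hump argument the part
  that does not involve the first variables is uniformly small once enough of them are discarded.
  The remaining part is a finite sum of monomials in the first variables times polynomials in the
  others that have smaller degree, to which the induction hypothesis applies.
\<close>

lemma homogeneous_truncations_uniformly_Cauchy:
  assumes r: "\<And>j. 0 < r j"
    and bd: "\<And>L w. w \<in> polydisc r \<Longrightarrow> cmod (msum c (exponents d {K..<L}) w) \<le> M"
  shows "uniformly_Cauchy_on (polydisc r) (\<lambda>L. msum c (exponents d {K..<L}))"
  using bd
proof (induction d arbitrary: c K M rule: less_induct)
  case (less d)
  show ?case
  proof (cases "d = 0")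
    case True
    then show ?thesis by (simp add: exponents_0 uniformly_Cauchy_on_const)
  next
    case False
    then have d: "d > 0" by simp
    have r0: "0 \<le> r j" for j using r[of j] by simp
    let ?P = "\<lambda>K L. msum c (exponents d {K..<L})"
    have step: "uniformly_Cauchy_on (polydisc r) (\<lambda>L w. ?P K' L w - ?P (Suc K') L w)" if "K \<le> K'" for K'
    proof (rule uniformly_Cauchy_on_eventually_cong)
      let ?c = "\<lambda>v m. c (m + Poly_Mapping.single K' v)"
      show "uniformly_Cauchy_on (polydisc r) (\<lambda>L w. \<Sum>v=1..d. w K' ^ v * msum (?c v) (exponents (d - v) {Suc K'..<L}) w)"
      proof (rule uniformly_Cauchy_on_sum)
        fix v assume v: "v \<in> {1..d}"
        have "uniformly_Cauchy_on (polydisc r) (\<lambda>L. msum (?c v) (exponents (d - v) {Suc K'..<L}))"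
        proof (rule less.IH)
          show "d - v < d" using v by auto
          show "cmod (msum (?c v) (exponents (d - v) {Suc K'..<L}) w) \<le> M / r K' ^ v"
            if "w \<in> polydisc r" for L w
            using v that by (intro shift_bounded[OF r bounded_tail[OF less.prems \<open>K \<le> K'\<close>]]) auto
        qed
        then show "uniformly_Cauchy_on (polydisc r) (\<lambda>L w. w K' ^ v * msum (?c v) (exponents (d - v) {Suc K'..<L}) w)"
          by (rule uniformly_Cauchy_on_bounded_mult[where B = "r K' ^ v"])
            (auto simp: polydisc_def norm_power intro: power_mono)
      qed
      show "(\<Sum>v=1..d. w K' ^ v * msum (?c v) (exponents (d - v) {Suc K'..<L}) w) = ?P K' L w - ?P (Suc K') L w"
        if "L \<ge> Suc K'" for L w
        using that by (subst msum_peel[of K' L]) auto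
    qed
    have diff: "uniformly_Cauchy_on (polydisc r) (\<lambda>L w. ?P K L w - ?P K' L w)" if "K \<le> K'" for K'
      using that
    proof (induction K' rule: dec_induct)
      case base
      show ?case by (simp add: uniformly_Cauchy_on_const)
    next
      case (step n)
      then show ?case
        using uniformly_Cauchy_on_add[OF step.IH \<open>K \<le> n \<Longrightarrow> _\<close>[OF step.hyps(1)]] by simp
    qed
    show ?thesis
    proof (rule uniformly_Cauchy_onI)
      fix e :: real assume e: "e > 0"
      then have e3: "e / 3 > 0" by simp
      obtain K' where K': "K' \<ge> K" "\<And>L w. w \<in> polydisc r \<Longrightarrow> cmod (?P K' L w) \<le> e / 3"
        using homogeneous_tail_small[where r = r and c = c and K = K and M = M, OF d r0 less.prems e3]
        by blast
      obtain N where N: "\<And>w m n. w \<in> polydisc r \<Longrightarrow> m \<ge> N \<Longrightarrow> n \<ge> N \<Longrightarrow>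
          dist (?P K m w - ?P K' m w) (?P K n w - ?P K' n w) < e / 3"
        using diff[OF K'(1)] e3 unfolding uniformly_Cauchy_on_def by meson
      have "dist (?P K m w) (?P K n w) < e" if "w \<in> polydisc r" "m \<ge> N" "n \<ge> N" for w m n
      proof -
        have "cmod (?P K m w - ?P K n w)
            \<le> cmod ((?P K m w - ?P K' m w) - (?P K n w - ?P K' n w)) + (cmod (?P K' m w) + cmod (?P K' n w))"
          using norm_triangle_ineq[of "(?P K m w - ?P K' m w) - (?P K n w - ?P K' n w)" "?P K' m w - ?P K' n w"]
            norm_triangle_ineq4[of "?P K' m w" "?P K' n w"] by simp
        then show ?thesis
          using N[OF that] K'(2)[OF that(1), of m] K'(2)[OF that(1), of n] by (simp add: dist_norm)
      qed
      then show "\<exists>N. \<forall>w\<in>polydisc r. \<forall>m\<ge>N. \<forall>n\<ge>N. dist (?P K m w) (?P K n w) < e" by blast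
    qed
  qed
qed

section \<open>Taylor coefficients of entire functions\<close>

lemma c0_eqI: "(\<And>j. coord x j = coord y j) \<Longrightarrow> x = y"
  by (metis coord_inject ext)

lemmas coord_simps = scaleC_c0.rep_eq plus_c0.rep_eq zero_c0.rep_eq minus_c0.rep_eq scaleR_c0.rep_eq

text \<open>The first \<open>L\<close> coordinates of a sequence, continued by 0, as an element of the space of null sequences.\<close>

definition trunc :: "nat \<Rightarrow> (nat \<Rightarrow> complex) \<Rightarrow> c0"
  where "trunc L w = Abs_c0 (\<lambda>j. if j \<in> {0..<L} then w j else 0)"

lemma coord_trunc: "coord (trunc L w) = (\<lambda>j. if j \<in> {0..<L} then w j else 0)"
  unfolding trunc_def
proof (rule Abs_c0_inverse, rule CollectI, rule tendsto_eventually)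
  show "eventually (\<lambda>j. (if j \<in> {0..<L} then w j else 0) = 0) sequentially"
    using eventually_ge_at_top[of L] by eventually_elim simp
qed

lemma trunc_cong: "(\<And>j. j < L \<Longrightarrow> w j = w' j) \<Longrightarrow> trunc L w = trunc L w'"
  by (rule c0_eqI) (simp add: coord_trunc)

lemma trunc_scale: "trunc L (\<lambda>i. t * w i) = scaleC_c0 t (trunc L w)"
  by (rule c0_eqI) (simp add: coord_trunc coord_simps)

lemma norm_scaleC: "norm (scaleC_c0 t z) \<le> cmod t * norm z"
  by (rule norm_c0_leI) (simp add: coord_simps norm_mult mult_left_mono cmod_coord_le_norm)

lemma scaleC_scaleC: "scaleC_c0 s (scaleC_c0 t z) = scaleC_c0 (s * t) z"
  by (rule c0_eqI) (simp add: coord_simps)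

lemma scaleC_one: "scaleC_c0 1 z = z"
  by (rule c0_eqI) (simp add: coord_simps)

lemma scaleC_add: "scaleC_c0 t (x + y) = scaleC_c0 t x + scaleC_c0 t y"
  by (rule c0_eqI) (simp add: coord_simps algebra_simps)

lemma bounded_linear_scaleC: "bounded_linear (\<lambda>t. scaleC_c0 t z)"
proof (rule bounded_linear_intro)
  show "norm (scaleC_c0 t z) \<le> norm t * norm z" for t by (rule norm_scaleC)
qed (auto intro!: c0_eqI simp: coord_simps algebra_simps scaleR_conv_of_real)

lemma continuous_on_scaleC [continuous_intros]:
  "continuous_on S h \<Longrightarrow> continuous_on S (\<lambda>p. scaleC_c0 (h p) z)"
  by (rule bounded_linear.continuous_on[OF bounded_linear_scaleC])

lemma continuous_entire: "f \<in> entire_c0 \<Longrightarrow> continuous_on S f"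
  by (auto simp: entire_c0_def intro: continuous_on_subset)

lemma holomorphic_on_line: "f \<in> entire_c0 \<Longrightarrow> (\<lambda>t. f (a + scaleC_c0 t b)) holomorphic_on UNIV"
  by (simp add: entire_c0_def)

lemma holomorphic_on_ray: "f \<in> entire_c0 \<Longrightarrow> (\<lambda>t. f (scaleC_c0 t z)) holomorphic_on UNIV"
  using holomorphic_on_line[of f 0 z] by simp

text \<open>The \<open>n\<close>-homogeneous part of the Taylor series at 0, read off on the complex line through \<open>z\<close>.\<close>

definition hpart :: "(c0 \<Rightarrow> complex) \<Rightarrow> nat \<Rightarrow> c0 \<Rightarrow> complex"
  where "hpart f n z = (deriv ^^ n) (\<lambda>t. f (scaleC_c0 t z)) 0 / fact n"

lemma hpart_sums:
  assumes "f \<in> entire_c0"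
  shows "(\<lambda>n. hpart f n z * t ^ n) sums f (scaleC_c0 t z)"
  using holomorphic_power_series[of "\<lambda>t. f (scaleC_c0 t z)" 0 "cmod t + 1" t]
    holomorphic_on_subset[OF holomorphic_on_ray[OF assms, of z]]
  by (simp add: hpart_def)

lemma hpart_bound:
  assumes f: "f \<in> entire_c0" and R: "R > 0"
    and bd: "\<And>t. cmod t = R \<Longrightarrow> cmod (f (scaleC_c0 t z)) \<le> M"
  shows "cmod (hpart f n z) \<le> M / R ^ n"
proof -
  have "cmod ((deriv ^^ n) (\<lambda>t. f (scaleC_c0 t z)) 0) \<le> fact n * M / R ^ n"
  proof (rule Cauchy_inequality)
    show "continuous_on (cball 0 R) (\<lambda>t. f (scaleC_c0 t z))"
      using holomorphic_on_imp_continuous_on[OF holomorphic_on_ray[OF f]] continuous_on_subset by blast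
    show "(\<lambda>t. f (scaleC_c0 t z)) holomorphic_on ball 0 R"
      using holomorphic_on_subset[OF holomorphic_on_ray[OF f]] by blast
  qed (use R bd in auto)
  then show ?thesis using R by (simp add: hpart_def norm_divide field_simps)
qed

lemma hpart_scale:
  assumes "f \<in> entire_c0"
  shows "hpart f n (scaleC_c0 t z) = t ^ n * hpart f n z"
  using higher_deriv_compose_linear[OF holomorphic_on_ray[OF assms, of z], of UNIV 0 t n]
  by (simp add: hpart_def scaleC_scaleC mult.commute)

text \<open>
  The homogeneous part is a limit of averages of \<open>f\<close> over rotations, at a rate that is uniform as
  long as \<open>f\<close> is bounded; hence it is holomorphic along lines, like these averages.
\<close>

lemma hpart_average_bound:
  assumes f: "f \<in> entire_c0" and bd: "\<And>t. cmod t = 4 \<Longrightarrow> cmod (f (scaleC_c0 t z)) \<le> M"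
    and N: "n < N"
  shows "cmod ((\<Sum>j<N. (unity_root N ^ j) powi (- int n) * f (scaleC_c0 (unity_root N ^ j) z)) / of_nat N
      - hpart f n z) \<le> 2 * M / 2 ^ N"
proof -
  define u where "u = unity_root N"
  define a where "a k = hpart f k z * (if int N dvd int k - int n then 1 else 0)" for k
  have M: "0 \<le> M" using order_trans[OF norm_ge_zero bd[of 4]] by simp
  have "(\<lambda>k. \<Sum>j<N. (u ^ j) powi (- int n) * (hpart f k z * (u ^ j) ^ k)) sums
      (\<Sum>j<N. (u ^ j) powi (- int n) * f (scaleC_c0 (u ^ j) z))"
    by (intro sums_sum sums_mult hpart_sums f)
  moreover have "(\<Sum>j<N. (u ^ j) powi (- int n) * (hpart f k z * (u ^ j) ^ k)) = of_nat N * a k" for k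
  proof -
    have "(\<Sum>j<N. (u ^ j) powi (- int n) * (hpart f k z * (u ^ j) ^ k))
        = hpart f k z * (\<Sum>j<N. (u ^ j) powi (int k - int n))"
      unfolding sum_distrib_left
      by (intro sum.cong refl) (simp add: u_def power_int_diff power_int_minus field_simps)
    also have "(\<Sum>j<N. (u ^ j) powi (int k - int n)) = (if int N dvd int k - int n then of_nat N else 0)"
      unfolding u_def using N by (intro sum_unity_root_powi) simp
    finally show ?thesis by (simp add: a_def)
  qed
  ultimately have "(\<lambda>k. of_nat N * a k / of_nat N) sums
      ((\<Sum>j<N. (u ^ j) powi (- int n) * f (scaleC_c0 (u ^ j) z)) / of_nat N)"
    by (intro sums_divide) simp
  then have "a sums ((\<Sum>j<N. (u ^ j) powi (- int n) * f (scaleC_c0 (u ^ j) z)) / of_nat N)"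
    using N by simp
  moreover have "(\<lambda>k. if k = n then hpart f k z else 0) sums hpart f n z" by (rule sums_single)
  ultimately have sums: "(\<lambda>k. a k - (if k = n then hpart f k z else 0)) sums
      ((\<Sum>j<N. (u ^ j) powi (- int n) * f (scaleC_c0 (u ^ j) z)) / of_nat N - hpart f n z)"
    by (rule sums_diff)
  have "cmod (a k - (if k = n then hpart f k z else 0)) \<le> M / 2 ^ N * (1 / 2) ^ k" for k
  proof (cases "N \<le> k")
    case True
    have "cmod (a k - (if k = n then hpart f k z else 0)) \<le> cmod (hpart f k z)"
      using True N by (simp add: a_def norm_mult)
    also have "\<dots> \<le> M / 4 ^ k" by (rule hpart_bound[OF f _ bd]) auto
    also have "\<dots> = M / 2 ^ k * (1 / 2) ^ k" by (simp add: power_divide flip: power_mult_distrib)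
    also have "\<dots> \<le> M / 2 ^ N * (1 / 2) ^ k"
      using True M by (intro mult_right_mono divide_left_mono power_increasing) auto
    finally show ?thesis .
  next
    case False
    have "int N dvd int k - int n \<longleftrightarrow> k = n"
      using False N by (intro int_dvd_diff_iff_eq) auto
    then show ?thesis using M by (simp add: a_def)
  qed
  moreover have geo: "(\<lambda>k. M / 2 ^ N * (1 / 2) ^ k) sums (M / 2 ^ N * (1 / (1 - 1 / 2)))"
    by (intro sums_mult geometric_sums) simp
  ultimately have "cmod (suminf (\<lambda>k. a k - (if k = n then hpart f k z else 0))) \<le> suminf (\<lambda>k. M / 2 ^ N * (1 / 2) ^ k)"
    by (intro norm_suminf_le) (auto simp: sums_iff)
  then show ?thesis using sums_unique[OF sums] sums_unique[OF geo] by (simp add: u_def mult.commute)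
qed

lemma hpart_holomorphic_on_line:
  assumes f: "f \<in> entire_c0"
  shows "(\<lambda>s. hpart f n (x + scaleC_c0 s y)) holomorphic_on UNIV"
proof (rule holomorphic_uniform_sequence[OF open_UNIV])
  define A where "A N s = (\<Sum>j<Suc (N + n). (unity_root (Suc (N + n)) ^ j) powi (- int n)
      * f (scaleC_c0 (unity_root (Suc (N + n)) ^ j) (x + scaleC_c0 s y))) / of_nat (Suc (N + n))" for N s
  \<comment> \<open>as \<open>t (x + s y) = t x + s (t y)\<close> runs along a line\<close>
  have "(\<lambda>s. f (scaleC_c0 t (x + scaleC_c0 s y))) holomorphic_on UNIV" for t
    using holomorphic_on_line[OF f, of "scaleC_c0 t x" "scaleC_c0 t y"]
    by (simp add: scaleC_add scaleC_scaleC mult.commute)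
  then show "A N holomorphic_on UNIV" for N
    unfolding A_def by (intro holomorphic_intros) auto
  show "\<exists>d>0. cball s0 d \<subseteq> UNIV \<and>
      uniform_limit (cball s0 d) A (\<lambda>s. hpart f n (x + scaleC_c0 s y)) sequentially" for s0
  proof (intro exI[of _ 1] conjI)
    let ?g = "\<lambda>p. f (scaleC_c0 (fst p) (x + scaleC_c0 (snd p) y))"
    have "compact (?g ` (cball 0 4 \<times> cball s0 1))"
      unfolding scaleC_add scaleC_scaleC
      by (intro compact_continuous_image compact_Times compact_cball
          continuous_on_compose2[OF continuous_entire[OF f, of UNIV]] continuous_intros) auto
    then have "bounded (?g ` (cball 0 4 \<times> cball s0 1))" by (rule compact_imp_bounded)
    then obtain M where M: "\<And>p. p \<in> cball 0 4 \<times> cball s0 1 \<Longrightarrow> cmod (?g p) \<le> M"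
      unfolding bounded_iff by blast
    have bd: "cmod (A N s - hpart f n (x + scaleC_c0 s y)) \<le> 2 * M / 2 ^ Suc (N + n)"
      if "s \<in> cball s0 1" for N s
      unfolding A_def
    proof (rule hpart_average_bound[OF f])
      show "cmod (f (scaleC_c0 t (x + scaleC_c0 s y))) \<le> M" if "cmod t = 4" for t
        using M[of "(t, s)"] \<open>s \<in> cball s0 1\<close> that by simp
    qed simp
    have "(\<lambda>N. 2 * M / 2 ^ Suc (N + n)) \<longlonglongrightarrow> 0" by real_asymp
    then have ev: "eventually (\<lambda>N. 2 * M / 2 ^ Suc (N + n) < e) sequentially" if "e > 0" for e
      using that by (rule order_tendstoD)
    show "uniform_limit (cball s0 1) A (\<lambda>s. hpart f n (x + scaleC_c0 s y)) sequentially"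
    proof (rule uniform_limitI)
      fix e :: real assume "e > 0"
      show "\<forall>\<^sub>F N in sequentially. \<forall>s\<in>cball s0 1. dist (A N s) (hpart f n (x + scaleC_c0 s y)) < e"
        using ev[OF \<open>e > 0\<close>] by eventually_elim (use bd le_less_trans in \<open>fastforce simp: dist_norm\<close>)
    qed
  qed auto
qed

lemma hpart_polynomial_on_line:
  assumes f: "f \<in> entire_c0"
  obtains a where "\<And>s. hpart f n (x + scaleC_c0 s y) = (\<Sum>k\<le>n. a k * s ^ k)"
proof -
  have "\<exists>d>0. \<forall>z\<in>UNIV. dist z 0 < d \<longrightarrow> dist (f z) (f 0) < 1"
    using continuous_entire[OF f, of UNIV] zero_less_one unfolding continuous_on_iff by blast
  then obtain \<rho>' where \<rho>': "\<rho>' > 0" "\<And>z. dist z 0 < \<rho>' \<Longrightarrow> dist (f z) (f 0) < 1"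
    by blast
  define \<rho> where "\<rho> = \<rho>' / 2"
  have \<rho>: "\<rho> > 0" using \<rho>'(1) by (simp add: \<rho>_def)
  define C where "C = cmod (f 0) + 1"
  have C: "cmod (f z) \<le> C" if "norm z \<le> \<rho>" for z
    using \<rho>'(2)[of z] that \<rho>'(1) norm_triangle_sub[of "f z" "f 0"] by (simp add: \<rho>_def C_def dist_norm)
  define b where "b = norm x + norm y + 1"
  have b: "b > 0" by (simp add: b_def add_nonneg_pos)
  have "cmod (hpart f n (x + scaleC_c0 s y)) \<le> C * (b / \<rho>) ^ n * cmod s ^ n" if s: "1 \<le> cmod s" for s
  proof -
    have "cmod (hpart f n (x + scaleC_c0 s y)) \<le> C / (\<rho> / (b * cmod s)) ^ n"
    proof (rule hpart_bound[OF f])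
      show "\<rho> / (b * cmod s) > 0" using \<rho> b s by (intro divide_pos_pos mult_pos_pos) auto
      fix t assume t: "cmod t = \<rho> / (b * cmod s)"
      have "norm (x + scaleC_c0 s y) \<le> norm x + cmod s * norm y"
        using norm_triangle_ineq[of x "scaleC_c0 s y"] norm_scaleC[of s y] by simp
      also have "\<dots> \<le> cmod s * norm x + cmod s * norm y"
        using mult_right_mono[OF s, of "norm x"] by simp
      also have "\<dots> \<le> b * cmod s" by (simp add: b_def algebra_simps)
      finally have "cmod t * norm (x + scaleC_c0 s y) \<le> cmod t * (b * cmod s)"
        by (intro mult_left_mono) auto
      also have "\<dots> = \<rho>" using t b s by auto
      finally show "cmod (f (scaleC_c0 t (x + scaleC_c0 s y))) \<le> C"
        using norm_scaleC[of t "x + scaleC_c0 s y"] by (intro C) linarith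
    qed
    also have "\<dots> = C * (b / \<rho>) ^ n * cmod s ^ n"
      using \<rho> b s by (simp add: power_divide power_mult_distrib field_simps)
    finally show ?thesis .
  qed
  \<comment> \<open>growth of order \<open>n\<close> forces a polynomial of degree at most \<open>n\<close>\<close>
  from Liouville_polynomial[OF hpart_holomorphic_on_line[OF f] this] show ?thesis
    by (rule that[where a = "\<lambda>k. (deriv ^^ k) (\<lambda>s. hpart f n (x + scaleC_c0 s y)) 0 / fact k"])
qed

lemma polynomial_coefficient_average:
  assumes "k \<le> n"
  shows "(\<Sum>j<Suc n. (unity_root (Suc n) ^ j) powi (- int k) * (\<Sum>i\<le>n. a i * (unity_root (Suc n) ^ j) ^ i))
    / of_nat (Suc n) = a k"
proof -
  let ?u = "unity_root (Suc n)"
  have "(\<Sum>j<Suc n. (?u ^ j) powi (- int k) * (\<Sum>i\<le>n. a i * (?u ^ j) ^ i))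
      = (\<Sum>j<Suc n. \<Sum>i\<le>n. a i * ((?u ^ j) powi (- int k) * (?u ^ j) ^ i))"
    by (simp only: sum_distrib_left mult.left_commute)
  also have "\<dots> = (\<Sum>i\<le>n. a i * (\<Sum>j<Suc n. (?u ^ j) powi (- int k) * (?u ^ j) ^ i))"
    by (subst sum.swap) (simp only: sum_distrib_left)
  also have "\<dots> = (\<Sum>i\<le>n. if i = k then a i * of_nat (Suc n) else 0)"
    using assms by (intro sum.cong refl, subst sum_unity_root_select) auto
  also have "\<dots> = a k * of_nat (Suc n)" using assms by (simp add: sum.delta)
  finally show ?thesis by (simp del: of_nat_Suc)
qed

text \<open>
  A function of \<open>L\<close> variables that is a polynomial in each of them, with a common bound on the
  degrees, is a polynomial.  Averages over roots of unity of order \<open>n + 1\<close> give the coefficients with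
  respect to the last variable as functions of the others.
\<close>

lemma separately_polynomial_imp_polynomial:
  assumes "\<And>w w'. (\<And>i. i < L \<Longrightarrow> w i = w' i) \<Longrightarrow> G w = G w'"
    and "\<And>i w. i < L \<Longrightarrow> \<exists>a. \<forall>t. G (w(i := t)) = (\<Sum>k\<le>n. a k * t ^ k)"
  shows "\<exists>A c. finite A \<and> (\<forall>m\<in>A. Poly_Mapping.keys m \<subseteq> {0..<L}) \<and> (\<forall>w. G w = msum c A w)"
  using assms
proof (induction L arbitrary: G)
  case 0
  show ?case
  proof (intro exI conjI allI)
    show "G w = msum (\<lambda>_. G (\<lambda>_. 0)) {0} w" for w
      using 0(1)[of w "\<lambda>_. 0"] by (simp add: msum_def)
  qed auto
next
  case (Suc L)
  define u where "u = unity_root (Suc n)"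
  define H where "H k w = (\<Sum>j<Suc n. (u ^ j) powi (- int k) * G (w(L := u ^ j))) / of_nat (Suc n)" for k w
  have G_eq: "G w = (\<Sum>k\<le>n. H k w * w L ^ k)" for w
  proof -
    obtain a where a: "\<And>t. G (w(L := t)) = (\<Sum>k\<le>n. a k * t ^ k)"
      using Suc.prems(2)[of L w] by blast
    have "H k w = a k" if "k \<le> n" for k
      unfolding H_def a u_def by (rule polynomial_coefficient_average[OF that])
    then show ?thesis using a[of "w L"] by simp
  qed
  have "\<exists>A c. finite A \<and> (\<forall>m\<in>A. Poly_Mapping.keys m \<subseteq> {0..<L}) \<and> (\<forall>w. H k w = msum c A w)" for k
  proof (rule Suc.IH)
    show "H k w = H k w'" if "\<And>i. i < L \<Longrightarrow> w i = w' i" for w w'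
    proof -
      have "G (w(L := t)) = G (w'(L := t))" for t
        by (rule Suc.prems(1)) (use that in \<open>auto simp: less_Suc_eq\<close>)
      then show ?thesis by (simp add: H_def)
    qed
    show "\<exists>a. \<forall>t. H k (w(i := t)) = (\<Sum>k\<le>n. a k * t ^ k)" if i: "i < L" for i w
    proof -
      have "\<exists>a. \<forall>t. G ((w(L := u ^ j))(i := t)) = (\<Sum>k\<le>n. a k * t ^ k)" for j
        by (rule Suc.prems(2)) (use i in simp)
      then obtain a where a: "\<And>j t. G ((w(L := u ^ j))(i := t)) = (\<Sum>k\<le>n. a j k * t ^ k)"
        by metis
      have "H k (w(i := t)) = (\<Sum>l\<le>n. ((\<Sum>j<Suc n. (u ^ j) powi (- int k) * a j l) / of_nat (Suc n)) * t ^ l)" for t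
      proof -
        have "H k (w(i := t)) = (\<Sum>j<Suc n. (u ^ j) powi (- int k) * (\<Sum>l\<le>n. a j l * t ^ l)) / of_nat (Suc n)"
        proof -
          have twist: "w(i := t, L := s) = w(L := s, i := t)" for s
            using i by (intro fun_upd_twist) simp
          show ?thesis unfolding H_def twist a ..
        qed
        also have "(\<Sum>j<Suc n. (u ^ j) powi (- int k) * (\<Sum>l\<le>n. a j l * t ^ l))
            = (\<Sum>l\<le>n. (\<Sum>j<Suc n. (u ^ j) powi (- int k) * a j l) * t ^ l)"
          unfolding sum_distrib_left sum_distrib_right by (subst sum.swap) (simp only: mult.assoc)
        finally show ?thesis by (simp only: times_divide_eq_left sum_divide_distrib[symmetric])
      qed
      then show ?thesis
        by (intro exI[of _ "\<lambda>l. (\<Sum>j<Suc n. (u ^ j) powi (- int k) * a j l) / of_nat (Suc n)"] allI)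
    qed
  qed
  then obtain A c where A: "\<And>k. finite (A k)" "\<And>k m. m \<in> A k \<Longrightarrow> Poly_Mapping.keys m \<subseteq> {0..<L}"
    "\<And>k w. H k w = msum (c k) (A k) w" by metis
  let ?s = "Poly_Mapping.single L"
  have expoL: "expo (m + ?s k) L = k" if "m \<in> A k" for m k
    using A(2)[OF that] by (auto simp: lookup_add in_keys_iff subset_iff)
  define B where "B = (\<Union>k\<le>n. (\<lambda>m. m + ?s k) ` A k)"
  define c' where "c' m = c (expo m L) (m - ?s (expo m L))" for m
  have "G w = msum c' B w" for w
  proof -
    have "msum c' B w = (\<Sum>k\<le>n. \<Sum>m\<in>(\<lambda>m. m + ?s k) ` A k. c' m * mon m w)"
      unfolding msum_def B_def
    proof (rule sum.UNION_disjoint)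
      show "\<forall>i\<in>{..n}. \<forall>j\<in>{..n}. i \<noteq> j \<longrightarrow> (\<lambda>m. m + ?s i) ` A i \<inter> (\<lambda>m. m + ?s j) ` A j = {}"
        using expoL by (metis (no_types, lifting) disjoint_iff imageE)
    qed (use A(1) in auto)
    also have "\<dots> = (\<Sum>k\<le>n. \<Sum>m\<in>A k. c' (m + ?s k) * mon (m + ?s k) w)"
    proof (rule sum.cong[OF refl])
      show "(\<Sum>m\<in>(\<lambda>m. m + ?s k) ` A k. c' m * mon m w)
          = (\<Sum>m\<in>A k. c' (m + ?s k) * mon (m + ?s k) w)" for k
        by (subst sum.reindex) (auto intro: inj_onI)
    qed
    also have "\<dots> = (\<Sum>k\<le>n. \<Sum>m\<in>A k. c k m * mon m w * w L ^ k)"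
      by (intro sum.cong refl) (simp add: c'_def expoL mon_add mon_single)
    also have "\<dots> = G w" unfolding G_eq A(3) msum_def by (simp only: sum_distrib_right)
    finally show ?thesis by simp
  qed
  moreover have "Poly_Mapping.keys m \<subseteq> {0..<Suc L}" if mB: "m \<in> B" for m
  proof -
    obtain k m' where m': "m = m' + ?s k" "m' \<in> A k" using mB by (auto simp: B_def)
    have "Poly_Mapping.keys m \<subseteq> Poly_Mapping.keys m' \<union> Poly_Mapping.keys (?s k)"
      unfolding m'(1) by (rule Poly_Mapping.keys_add)
    also have "\<dots> \<subseteq> {0..<L} \<union> {L}" using A(2)[OF m'(2)] by auto
    finally show ?thesis by auto
  qed
  moreover have "finite B" using A(1) by (simp add: B_def)
  ultimately show ?case by blast
qed

lemma homogeneous_polynomial_exponents: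
  assumes fin: "finite A" and keys: "\<And>m. m \<in> A \<Longrightarrow> Poly_Mapping.keys m \<subseteq> I" and I: "finite I"
    and G: "\<And>w. G w = msum c A w" and hom: "\<And>t w. G (\<lambda>i. t * w i) = t ^ n * G w"
  obtains c' where "\<And>w. G w = msum c' (exponents n I) w"
proof -
  define N where "N = Suc (n + (\<Sum>m\<in>A. modulus m))"
  have N: "n < N" "N > 0" by (auto simp: N_def)
  have lt: "modulus m < N" if "m \<in> A" for m
    using member_le_sum[of m A modulus] that fin by (auto simp: N_def)
  define u where "u = unity_root N"
  define c' where "c' m = (if m \<in> A then c m else 0)" for m
  have "G w = msum c' (exponents n I) w" for w
  proof -
    have "of_nat N * G w = (\<Sum>j<N. (u ^ j) powi (- int n) * G (\<lambda>i. u ^ j * w i))"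
    proof -
      have "(u ^ j) powi (- int n) * G (\<lambda>i. u ^ j * w i) = G w" for j
        unfolding hom by (simp add: u_def power_int_minus)
      then show ?thesis by simp
    qed
    also have "\<dots> = (\<Sum>j<N. \<Sum>m\<in>A. c m * mon m w * ((u ^ j) powi (- int n) * (u ^ j) ^ modulus m))"
      unfolding G msum_def mon_scale by (simp only: sum_distrib_left mult_ac)
    also have "\<dots> = (\<Sum>m\<in>A. c m * mon m w * (\<Sum>j<N. (u ^ j) powi (- int n) * (u ^ j) ^ modulus m))"
      by (subst sum.swap) (simp only: sum_distrib_left)
    also have "\<dots> = (\<Sum>m\<in>A. c m * mon m w * (if modulus m = n then of_nat N else 0))"
      using sum_unity_root_select[OF N(1) lt] by (intro sum.cong refl) (simp add: u_def)
    also have "\<dots> = of_nat N * (\<Sum>m | m \<in> A \<and> modulus m = n. c m * mon m w)"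
      using fin by (simp add: sum.inter_filter sum_distrib_left mult_ac if_distrib cong: if_cong)
    also have "(\<Sum>m | m \<in> A \<and> modulus m = n. c m * mon m w) = msum c' (exponents n I) w"
      unfolding msum_def using finite_exponents[OF I] keys
      by (intro sum.mono_neutral_cong_left) (auto simp: exponents_def c'_def)
    finally show ?thesis using N by simp
  qed
  then show ?thesis by (rule that)
qed

lemma hpart_trunc_polynomial:
  assumes f: "f \<in> entire_c0"
  shows "\<exists>c. \<forall>w. hpart f n (trunc L w) = msum c (exponents n {0..<L}) w"
proof -
  define G where "G w = hpart f n (trunc L w)" for w
  have "\<exists>A c. finite A \<and> (\<forall>m\<in>A. Poly_Mapping.keys m \<subseteq> {0..<L}) \<and> (\<forall>w. G w = msum c A w)"
  proof (rule separately_polynomial_imp_polynomial)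
    show "G w = G w'" if "\<And>i. i < L \<Longrightarrow> w i = w' i" for w w'
      using trunc_cong[of L w w'] that by (simp add: G_def)
    show "\<exists>a. \<forall>t. G (w(i := t)) = (\<Sum>k\<le>n. a k * t ^ k)" if i: "i < L" for i w
    proof -
      have eq: "trunc L (w(i := t)) = trunc L (w(i := 0)) + scaleC_c0 t (trunc L (\<lambda>j. if j = i then 1 else 0))" for t
        by (rule c0_eqI) (use i in \<open>simp add: coord_trunc coord_simps\<close>)
      obtain a where a: "\<And>t. hpart f n (trunc L (w(i := 0))
          + scaleC_c0 t (trunc L (\<lambda>j. if j = i then 1 else 0))) = (\<Sum>k\<le>n. a k * t ^ k)"
        using hpart_polynomial_on_line[OF f] by blast
      have "G (w(i := t)) = (\<Sum>k\<le>n. a k * t ^ k)" for t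
        unfolding G_def by (subst eq) (rule a)
      then show ?thesis by blast
    qed
  qed
  then obtain A c where "finite A" "\<And>m. m \<in> A \<Longrightarrow> Poly_Mapping.keys m \<subseteq> {0..<L}"
    "\<And>w. G w = msum c A w" by blast
  from homogeneous_polynomial_exponents[OF this(1,2) _ this(3), of n] obtain c'
    where "\<And>w. G w = msum c' (exponents n {0..<L}) w"
    by (auto simp: G_def trunc_scale hpart_scale[OF f])
  then show ?thesis by (auto simp: G_def)
qed

lemma msum_coefficients_unique:
  assumes "finite X" "\<And>w. msum c X w = msum c' X w" "m \<in> X"
  shows "c m = c' m"
proof -
  have "cmod ((c m - c' m) * mon m (\<lambda>_. 1)) \<le> 0"
  proof (rule coefficient_bound[where c = "\<lambda>m. c m - c' m" and r = "\<lambda>_. 1"])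
    show "cmod (msum (\<lambda>m. c m - c' m) X w) \<le> 0" for w
      using assms(2)[of w] by (simp add: msum_def left_diff_distrib sum_subtractf)
  qed (use assms in \<open>auto simp: polydisc_def\<close>)
  then show ?thesis by (simp add: mon_def)
qed

text \<open>
  The coefficients on \<open>L\<close> variables, given by finite-dimensional polynomials, do not depend on \<open>L\<close>, by
  uniqueness of the coefficients of polynomials.
\<close>

theorem taylor_coefficients_exist:
  assumes f: "f \<in> entire_c0"
  obtains c where "\<And>n L w. hpart f n (trunc L w) = msum c (exponents n {0..<L}) w"
proof -
  obtain C where C: "\<And>n L w. hpart f n (trunc L w) = msum (C n L) (exponents n {0..<L}) w"
    using hpart_trunc_polynomial[OF f] by metis
  have consistent: "C n L m = C n L' m" if "L \<le> L'" "m \<in> exponents n {0..<L}" for n L L' m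
  proof (rule msum_coefficients_unique[OF finite_exponents _ that(2)])
    fix w
    have "{m \<in> exponents n {0..<L'}. Poly_Mapping.keys m \<subseteq> {0..<L}} = exponents n {0..<L}"
      using that(1) by (fastforce simp: exponents_def)
    then have "msum (C n L') (exponents n {0..<L}) w = hpart f n (trunc L' (\<lambda>i. if i \<in> {0..<L} then w i else 0))"
      by (simp only: C msum_restrict_arg finite_exponents finite_atLeastLessThan)
    also have "trunc L' (\<lambda>i. if i \<in> {0..<L} then w i else 0) = trunc L w"
      by (rule c0_eqI) (use that(1) in \<open>auto simp: coord_trunc\<close>)
    finally show "msum (C n L) (exponents n {0..<L}) w = msum (C n L') (exponents n {0..<L}) w"
      by (simp add: C)
  qed simp
  define c where "c m = C (modulus m) (len m) m" for m
  have "hpart f n (trunc L w) = msum c (exponents n {0..<L}) w" for n L w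
    unfolding C msum_def
  proof (rule sum.cong[OF refl])
    fix m assume m: "m \<in> exponents n {0..<L}"
    then have "m \<in> exponents n {0..<len m}" "len m \<le> L"
      using less_len[of _ m] by (auto simp: exponents_def intro!: len_le)
    then have "C n L m = c m" using consistent[of "len m" L m n] m by (simp add: c_def exponents_def)
    then show "C n L m * mon m w = c m * mon m w" by simp
  qed
  then show ?thesis by (rule that)
qed

section \<open>Local uniform convergence of the monomial expansion\<close>

lemma bounded_linear_coord: "bounded_linear (\<lambda>z. coord z j)"
proof (rule bounded_linear_intro)
  show "norm (coord z j) \<le> norm z * 1" for z by (simp add: cmod_coord_le_norm)
qed (auto simp: coord_simps)

lemma continuous_on_coord [continuous_intros]: "continuous_on S (\<lambda>z. coord z j)"
  by (rule bounded_linear.continuous_on[OF bounded_linear_coord continuous_on_id])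

lemma continuous_on_msum: "continuous_on S (\<lambda>z. msum c A (coord z))"
  unfolding msum_def mon_def by (intro continuous_intros)

lemma monomial_sum_entire: "(\<lambda>z. \<Sum>k\<in>K. a k * monom_c0 (e k) z) \<in> entire_c0"
  unfolding entire_c0_def monom_c0_def
  by (auto simp: coord_simps intro!: continuous_intros holomorphic_intros)

lemma entire_diff: "f \<in> entire_c0 \<Longrightarrow> g \<in> entire_c0 \<Longrightarrow> (\<lambda>z. f z - g z) \<in> entire_c0"
  unfolding entire_c0_def by (auto intro!: continuous_on_diff holomorphic_on_diff)

lemma trunc_tendsto: "(\<lambda>L. trunc L (coord z)) \<longlonglongrightarrow> z"
proof (rule metric_LIMSEQ_I)
  fix e :: real assume e: "e > 0"
  obtain N where N: "\<And>j. j \<ge> N \<Longrightarrow> cmod (coord z j) < e / 2"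
    using LIMSEQ_D[OF coord_tendsto, of "e / 2" z] e by auto
  have "dist (trunc L (coord z)) z < e" if "L \<ge> N" for L
  proof -
    have "norm (trunc L (coord z) - z) \<le> e / 2"
    proof (rule norm_c0_leI)
      show "cmod (coord (trunc L (coord z) - z) j) \<le> e / 2" for j
        using N[of j] that e by (auto simp: coord_simps coord_trunc)
    qed
    then show ?thesis using e by (simp add: dist_norm)
  qed
  then show "\<exists>N. \<forall>L\<ge>N. dist (trunc L (coord z)) z < e" by blast
qed

lemma compatible_order_initial:
  assumes "compatible_order e" "m \<in> e ` {..<N}" "modulus m' = modulus m" "colex m' m"
  shows "m' \<in> e ` {..<N}"
proof -
  have "surj e" using assms(1) by (simp add: compatible_order_def bij_is_surj)
  then obtain i where i: "m' = e i" by (metis surjD)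
  obtain j where j: "m = e j" "j < N" using assms(2) by blast
  have "i < j" using assms colex_imp_square_less[of m' m] i j by (auto simp: compatible_order_def)
  then show ?thesis using i j by auto
qed

lemma compatible_order_initial_bound:
  assumes e: "compatible_order e" and X: "X \<subseteq> exponents n {0..<L}"
    and bd: "\<And>w. w \<in> polydisc r \<Longrightarrow> cmod (msum c X w) \<le> B" and w: "w \<in> polydisc r"
  shows "cmod (msum c (X \<inter> e ` {..<N}) w) \<le> real (n + 1) * B"
proof (rule initial_segment_bound[where X = X and L = L and r = r])
  show "finite X" using X finite_exponents finite_subset by blast
  show "(\<Sum>i<L. expo m i) = n" if "m \<in> X" for m
    using X that modulus_eq_sum[of "{..<L}" m] by (auto simp: exponents_def lessThan_atLeast0)
  show "m' \<in> X \<inter> e ` {..<N}" if "m \<in> X \<inter> e ` {..<N}" "m' \<in> X" "colex m' m" for m m'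
    using compatible_order_initial[OF e, of m N m'] that X by (auto simp: exponents_def)
  show "expo m i = expo m' i" if "m \<in> X" "m' \<in> X" "i \<ge> L" for m m' i
  proof -
    have "Poly_Mapping.keys m \<subseteq> {0..<L}" "Poly_Mapping.keys m' \<subseteq> {0..<L}"
      using that X by (auto simp: exponents_def)
    then have "i \<notin> Poly_Mapping.keys m" "i \<notin> Poly_Mapping.keys m'"
      using that(3) by auto
    then show ?thesis by (simp add: in_keys_iff)
  qed
qed (use bd w in auto)

lemma surj_finite_subset_initial:
  fixes e :: "nat \<Rightarrow> 'a"
  assumes "surj e" "finite S"
  obtains N where "S \<subseteq> e ` {..<N}"
proof -
  have "finite (inv e ` S)" using assms(2) by simp
  then obtain N where N: "\<forall>i\<in>inv e ` S. i < N" unfolding finite_nat_set_iff_bounded by blast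
  have "S \<subseteq> e ` {..<N}"
  proof
    fix s assume "s \<in> S"
    then have "e (inv e s) = s" "inv e s < N" using N assms(1) by (auto simp: surj_f_inv_f)
    then show "s \<in> e ` {..<N}" by (metis imageI lessThan_iff)
  qed
  then show ?thesis by (rule that)
qed

text \<open>
  By uniform approximation, the terms not supported in the first \<open>L0\<close> variables form a polynomial of
  small supremum.  Once all terms supported there occur in the partial sum, the remainder is this
  polynomial minus an initial segment of it, hence small, uniformly in the number \<open>L\<close> of variables.
\<close>

lemma homogeneous_remainder_small:
  assumes e: "compatible_order e" and r: "\<And>j. 0 < r j"
    and bd: "\<And>L w. w \<in> polydisc r \<Longrightarrow> cmod (msum c (exponents n {0..<L}) w) \<le> M"
    and \<epsilon>: "\<epsilon> > 0"
  shows "\<exists>N0. \<forall>N\<ge>N0. \<forall>L. \<forall>w\<in>polydisc r. cmod (msum c (exponents n {0..<L} - e ` {..<N}) w) \<le> \<epsilon>"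
proof -
  let ?P = "\<lambda>L. exponents n {0..<L}"
  define \<delta> where "\<delta> = \<epsilon> / real (n + 2)"
  have \<delta>: "\<delta> > 0" using \<epsilon> by (simp add: \<delta>_def)
  obtain L0 where L0: "\<And>w L L'. w \<in> polydisc r \<Longrightarrow> L \<ge> L0 \<Longrightarrow> L' \<ge> L0 \<Longrightarrow>
      dist (msum c (?P L) w) (msum c (?P L') w) < \<delta>"
    using homogeneous_truncations_uniformly_Cauchy[where c = c and r = r and K = 0 and d = n and M = M, OF r bd] \<delta>
    unfolding uniformly_Cauchy_on_def by meson
  have "surj e" using e by (simp add: compatible_order_def bij_is_surj)
  then obtain N0 where N0: "?P L0 \<subseteq> e ` {..<N0}"
    using surj_finite_subset_initial[of e "?P L0"] finite_exponents[of "{0..<L0}" n] by blast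
  have "cmod (msum c (?P L - e ` {..<N}) w) \<le> \<epsilon>" if N: "N \<ge> N0" and w: "w \<in> polydisc r" for N L w
  proof (cases "L \<ge> L0")
    case False
    then have "?P L \<subseteq> ?P L0" by (intro exponents_mono) auto
    also have "\<dots> \<subseteq> e ` {..<N}" using N0 N by auto
    finally have empty: "?P L - e ` {..<N} = {}" by blast
    show ?thesis unfolding empty using \<epsilon> by simp
  next
    case True
    define X where "X = ?P L - ?P L0"
    have sub: "?P L0 \<subseteq> ?P L" using True by (intro exponents_mono) auto
    have Xbd: "cmod (msum c X v) \<le> \<delta>" if "v \<in> polydisc r" for v
      unfolding X_def using L0[OF that True order_refl]
      by (subst msum_diff[OF finite_exponents sub]) (simp_all add: dist_norm)
    have Xsub: "X \<subseteq> ?P L" by (simp add: X_def)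
    have "?P L - e ` {..<N} = X - (X \<inter> e ` {..<N})" using N0 N by (auto simp: X_def)
    then have "msum c (?P L - e ` {..<N}) w = msum c X w - msum c (X \<inter> e ` {..<N}) w"
      using msum_diff[OF finite_subset[OF Xsub finite_exponents] Int_lower1, of c "e ` {..<N}" w]
      by (simp only: finite_atLeastLessThan)
    then have "cmod (msum c (?P L - e ` {..<N}) w) \<le> cmod (msum c X w) + cmod (msum c (X \<inter> e ` {..<N}) w)"
      by (simp add: norm_triangle_ineq4)
    also have "\<dots> \<le> \<delta> + real (n + 1) * \<delta>"
      by (intro add_mono Xbd w compatible_order_initial_bound[OF e Xsub Xbd w])
    also have "\<dots> = real (n + 2) * \<delta>" by (simp add: algebra_simps)
    also have "\<dots> = \<epsilon>" by (simp add: \<delta>_def)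
    finally show ?thesis .
  qed
  then show ?thesis by blast
qed

text \<open>The series has only finitely many nonzero terms.\<close>

lemma msum_sums_by_degree:
  assumes "finite A"
  shows "(\<lambda>n. msum c (exponents n {0..<L} \<inter> A) w) sums msum c A (coord (trunc L w))"
proof -
  define S where "S = {m \<in> A. Poly_Mapping.keys m \<subseteq> {0..<L}}"
  have fin: "finite S" using assms by (simp add: S_def)
  define D where "D = (\<Sum>m\<in>S. modulus m)"
  have D: "modulus m \<le> D" if "m \<in> S" for m
    using member_le_sum[of m S modulus] that fin by (auto simp: D_def)
  have eq: "exponents n {0..<L} \<inter> A = {m \<in> S. modulus m = n}" for n
    by (auto simp: exponents_def S_def)
  have "(\<lambda>n. msum c {m \<in> S. modulus m = n} w) sums (\<Sum>n\<le>D. msum c {m \<in> S. modulus m = n} w)"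
  proof (rule sums_finite)
    show "msum c {m \<in> S. modulus m = n} w = 0" if "n \<notin> {..D}" for n
    proof -
      have "{m \<in> S. modulus m = n} = {}" using that D by auto
      then show ?thesis by (simp only: msum_empty)
    qed
  qed simp
  also have "(\<Sum>n\<le>D. msum c {m \<in> S. modulus m = n} w) = msum c S w"
    unfolding msum_def using D by (intro sum.group fin) auto
  also have "\<dots> = msum c A (coord (trunc L w))"
    unfolding coord_trunc S_def by (rule msum_restrict_arg[OF assms, symmetric])
  finally show ?thesis by (simp only: eq)
qed

text \<open>
  The homogeneous parts decay like $4^{-n}$ on the polydisc, so that a loss by a factor \<open>n + 1\<close> in
  degree \<open>n\<close> leaves a summable majorant.  Convergence in each degree then suffices.
\<close>

lemma monomial_expansion_truncated:
  assumes e: "compatible_order e" and f: "f \<in> entire_c0"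
    and c: "\<And>n L w. hpart f n (trunc L w) = msum c (exponents n {0..<L}) w"
    and r: "\<And>j. 0 < r j"
    and bd: "\<And>z. (\<And>j. cmod (coord z j) \<le> 4 * r j) \<Longrightarrow> cmod (f z) \<le> M"
    and \<epsilon>: "\<epsilon> > 0"
  shows "\<exists>N0. \<forall>N\<ge>N0. \<forall>L. \<forall>w\<in>polydisc r.
    cmod (f (trunc L w) - msum c (e ` {..<N}) (coord (trunc L w))) \<le> \<epsilon>"
proof -
  let ?P = "\<lambda>n L. exponents n {0..<L}"
  have M: "0 \<le> M"
  proof -
    have "cmod (f 0) \<le> M" using less_imp_le[OF r] by (intro bd) (simp add: coord_simps)
    then show ?thesis using norm_ge_zero order_trans by blast
  qed
  have hom: "cmod (msum c (?P n L) w) \<le> M / 4 ^ n" if w: "w \<in> polydisc r" for n L w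
    unfolding c[symmetric]
  proof (rule hpart_bound[OF f])
    fix t :: complex assume t: "cmod t = 4"
    show "cmod (f (scaleC_c0 t (trunc L w))) \<le> M"
    proof (rule bd)
      show "cmod (coord (scaleC_c0 t (trunc L w)) j) \<le> 4 * r j" for j
        using w less_imp_le[OF r[of j]] t by (auto simp: coord_simps coord_trunc norm_mult polydisc_def)
    qed
  qed simp
  define d where "d N L w n = msum c (?P n L - e ` {..<N}) w" for N L w n
  have d_eq: "d N L w n = msum c (?P n L) w - msum c (?P n L \<inter> e ` {..<N}) w" for N L w n
    using msum_diff[of "?P n L" "?P n L \<inter> e ` {..<N}" c w]
    by (simp add: d_def finite_exponents Diff_Int)
  have d_sums: "d N L w sums (f (trunc L w) - msum c (e ` {..<N}) (coord (trunc L w)))" for N L w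
  proof -
    have "(\<lambda>n. msum c (?P n L) w) sums f (trunc L w)"
      using hpart_sums[OF f, of "trunc L w" 1] by (simp add: c scaleC_one)
    then show ?thesis
      unfolding d_eq by (intro sums_diff msum_sums_by_degree) auto
  qed
  have d_bd: "cmod (d N L w n) \<le> 2 * M * (1 / 2) ^ n" if w: "w \<in> polydisc r" for N L w n
  proof -
    have "cmod (d N L w n) \<le> M / 4 ^ n + real (n + 1) * (M / 4 ^ n)"
      unfolding d_eq
      by (intro order_trans[OF norm_triangle_ineq4] add_mono hom w
          compatible_order_initial_bound[OF e order_refl hom w])
    also have "\<dots> = real (n + 2) * (M / 4 ^ n)" by (simp add: algebra_simps add_divide_distrib)
    also have "real (n + 2) \<le> 2 * 2 ^ n"
      by (induction n) auto
    then have "real (n + 2) * (M / 4 ^ n) \<le> 2 * 2 ^ n * (M / 4 ^ n)"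
      using M by (intro mult_right_mono) auto
    also have "\<dots> = 2 * M * (1 / 2) ^ n"
      by (simp add: power_divide field_simps flip: power_mult_distrib)
    finally show ?thesis .
  qed
  have "(\<lambda>n. 4 * M * (1 / 2) ^ n) \<longlonglongrightarrow> 4 * M * 0"
    by (intro tendsto_mult tendsto_const LIMSEQ_realpow_zero) auto
  then have "eventually (\<lambda>n. 4 * M * (1 / 2) ^ n < \<epsilon> / 2) sequentially"
    using \<epsilon> by (intro order_tendstoD) auto
  then obtain n0 where n0: "4 * M * (1 / 2) ^ n0 < \<epsilon> / 2"
    by (auto simp: eventually_sequentially)
  define \<delta> where "\<delta> = \<epsilon> / (2 * real (n0 + 1))"
  have \<delta>: "\<delta> > 0" using \<epsilon> by (simp add: \<delta>_def)
  have "\<exists>N0. \<forall>N\<ge>N0. \<forall>L. \<forall>w\<in>polydisc r. cmod (d N L w n) \<le> \<delta>" for n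
    unfolding d_def by (rule homogeneous_remainder_small[OF e r hom \<delta>])
  then obtain Nf where Nf: "\<And>n N L w. N \<ge> Nf n \<Longrightarrow> w \<in> polydisc r \<Longrightarrow> cmod (d N L w n) \<le> \<delta>"
    by metis
  define N0 where "N0 = (\<Sum>n<n0. Nf n)"
  have "cmod (f (trunc L w) - msum c (e ` {..<N}) (coord (trunc L w))) \<le> \<epsilon>"
    if N: "N \<ge> N0" and w: "w \<in> polydisc r" for N L w
  proof -
    let ?d = "d N L w"
    have "(\<lambda>n. ?d (n + n0)) sums (f (trunc L w) - msum c (e ` {..<N}) (coord (trunc L w)) - (\<Sum>n<n0. ?d n))"
      using d_sums[of N L w] by (rule sums_split_initial_segment)
    moreover have geo: "(\<lambda>n. 2 * M * (1 / 2) ^ n0 * (1 / 2) ^ n) sums (2 * M * (1 / 2) ^ n0 * (1 / (1 - 1 / 2)))"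
      by (intro sums_mult geometric_sums) simp
    have "cmod (?d (n + n0)) \<le> 2 * M * (1 / 2) ^ n0 * (1 / 2) ^ n" for n
      using d_bd[OF w, of N L "n + n0"] by (simp add: power_add mult_ac)
    then have "cmod (suminf (\<lambda>n. ?d (n + n0))) \<le> suminf (\<lambda>n. 2 * M * (1 / 2) ^ n0 * (1 / 2) ^ n)"
      using geo by (intro norm_suminf_le) (auto simp: sums_iff)
    ultimately have tail: "cmod (f (trunc L w) - msum c (e ` {..<N}) (coord (trunc L w)) - (\<Sum>n<n0. ?d n))
        \<le> 4 * M * (1 / 2) ^ n0"
      using sums_unique[OF geo] by (simp add: sums_iff)
    have "cmod (\<Sum>n<n0. ?d n) \<le> real (card {..<n0}) * \<delta>"
    proof (rule sum_norm_bound)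
      fix n assume n: "n \<in> {..<n0}"
      then have "Nf n \<le> N0" unfolding N0_def by (intro member_le_sum) auto
      then show "cmod (?d n) \<le> \<delta>" using N by (intro Nf w) auto
    qed
    also have "\<dots> \<le> \<epsilon> / 2" using \<epsilon> by (simp add: \<delta>_def field_simps)
    finally show ?thesis
      using tail n0 norm_triangle_sub[of "f (trunc L w) - msum c (e ` {..<N}) (coord (trunc L w))" "\<Sum>n<n0. ?d n"]
      by linarith
  qed
  then show ?thesis by blast
qed

text \<open>
  An entire function that is bounded on the polydisc of polyradius \<open>4 r\<close> is the uniform limit of its
  monomial expansion on the one of polyradius \<open>r\<close>.  The truncated estimate passes to the limit
  by continuity of \<open>f\<close>.
\<close>

proposition monomial_expansion_uniform:
  assumes e: "compatible_order e" and f: "f \<in> entire_c0"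
    and c: "\<And>n L w. hpart f n (trunc L w) = msum c (exponents n {0..<L}) w"
    and r: "\<And>j. 0 < r j"
    and bd: "\<And>z. (\<And>j. cmod (coord z j) \<le> 4 * r j) \<Longrightarrow> cmod (f z) \<le> M"
    and \<epsilon>: "\<epsilon> > 0"
  shows "\<exists>N0. \<forall>N\<ge>N0. \<forall>z. coord z \<in> polydisc r \<longrightarrow>
    cmod (f z - (\<Sum>k<N. c (e k) * monom_c0 (e k) z)) \<le> \<epsilon>"
proof -
  have inj: "inj_on e S" for S using e by (auto simp: compatible_order_def bij_def intro: inj_on_subset)
  have eq: "(\<Sum>k<N. c (e k) * monom_c0 (e k) z) = msum c (e ` {..<N}) (coord z)" for N z
    unfolding msum_def by (simp add: sum.reindex[OF inj] monom_c0_eq)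
  obtain N0 where N0: "\<And>N L w. N \<ge> N0 \<Longrightarrow> w \<in> polydisc r \<Longrightarrow>
      cmod (f (trunc L w) - msum c (e ` {..<N}) (coord (trunc L w))) \<le> \<epsilon>"
    using monomial_expansion_truncated[where r = r and M = M, OF e f c r bd \<epsilon>] by blast
  have "cmod (f z - msum c (e ` {..<N}) (coord z)) \<le> \<epsilon>" if "N \<ge> N0" "coord z \<in> polydisc r" for N z
  proof (rule tendsto_upperbound)
    have "continuous_on UNIV (\<lambda>z. f z - msum c (e ` {..<N}) (coord z))"
      by (intro continuous_on_diff continuous_entire f continuous_on_msum)
    from continuous_on_tendsto_compose[OF this trunc_tendsto[of z]]
    show "(\<lambda>L. cmod (f (trunc L (coord z)) - msum c (e ` {..<N}) (coord (trunc L (coord z)))))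
        \<longlonglongrightarrow> cmod (f z - msum c (e ` {..<N}) (coord z))"
      by (intro tendsto_norm) auto
    show "\<forall>\<^sub>F L in sequentially.
        cmod (f (trunc L (coord z)) - msum c (e ` {..<N}) (coord (trunc L (coord z)))) \<le> \<epsilon>"
      using N0[OF that] by simp
  qed simp
  then show ?thesis unfolding eq by blast
qed

section \<open>Compact sets in the space of null sequences\<close>

lemma coord_Abs_c0: "w \<longlonglongrightarrow> 0 \<Longrightarrow> coord (Abs_c0 w) = w"
  by (rule Abs_c0_inverse) simp

lemma null_dominated:
  assumes "\<beta> \<longlonglongrightarrow> 0" "\<And>j. cmod (w j) \<le> \<beta> j"
  shows "w \<longlonglongrightarrow> 0"
  by (rule Lim_null_comparison[OF _ assms(1)]) (simp add: assms(2))

text \<open>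
  A polydisc with null polyradius is compact by Tychonoff's theorem, since on it convergence of the
  coordinates implies convergence in norm.
\<close>

lemma compact_c0_polydisc:
  fixes \<beta> :: "nat \<Rightarrow> real"
  assumes \<beta>: "\<beta> \<longlonglongrightarrow> 0"
  shows "compact {z. coord z \<in> polydisc \<beta>}"
proof -
  have \<beta>_null: "coord (Abs_c0 w) = w" if "w \<in> polydisc \<beta>" for w
    using that by (intro coord_Abs_c0 null_dominated[OF \<beta>]) (auto simp: polydisc_def)
  have "compact (PiE UNIV (\<lambda>j. cball 0 (\<beta> j)) :: (nat \<Rightarrow> complex) set)"
    using compactin_PiE[of "\<lambda>_. euclidean" UNIV "\<lambda>j. cball (0::complex) (\<beta> j)"]
    by (simp add: euclidean_product_topology)
  moreover have "PiE UNIV (\<lambda>j. cball 0 (\<beta> j)) = polydisc \<beta>"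
    by (auto simp: polydisc_def)
  ultimately have "compact (polydisc \<beta>)" by simp
  moreover have "continuous_on (polydisc \<beta>) Abs_c0"
    unfolding continuous_on_def
  proof (intro ballI tendstoI)
    fix w and e :: real assume w: "w \<in> polydisc \<beta>" and e: "e > 0"
    obtain N where N: "\<And>j. j \<ge> N \<Longrightarrow> \<beta> j < e / 4"
      using order_tendstoD(2)[OF \<beta>, of "e / 4"] e by (auto simp: eventually_sequentially)
    have "((\<lambda>w'. w' j) \<longlongrightarrow> w j) (at w within polydisc \<beta>)" for j
      using continuous_on_subset[OF continuous_on_product_coordinates subset_UNIV, of "polydisc \<beta>" j] w
      by (simp add: continuous_on_def)
    then have "\<forall>\<^sub>F w' in at w within polydisc \<beta>. dist (w' j) (w j) < e / 2" for j
      using e by (intro tendstoD) auto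
    then have "\<forall>\<^sub>F w' in at w within polydisc \<beta>. \<forall>j\<in>{..<N}. dist (w' j) (w j) < e / 2"
      by (intro eventually_ball_finite) auto
    moreover have "\<forall>\<^sub>F w' in at w within polydisc \<beta>. w' \<in> polydisc \<beta>"
      by (simp add: eventually_at_filter)
    ultimately show "\<forall>\<^sub>F w' in at w within polydisc \<beta>. dist (Abs_c0 w') (Abs_c0 w) < e"
    proof eventually_elim
      case (elim w')
      have "norm (Abs_c0 w' - Abs_c0 w) \<le> e / 2"
      proof (rule norm_c0_leI)
        fix j
        have "cmod (w' j - w j) \<le> e / 2"
        proof (cases "j < N")
          case True
          then show ?thesis using elim(1) by (auto simp: dist_norm intro: less_imp_le)
        next
          case False
          then have "\<beta> j < e / 4" using N[of j] by simp
          moreover have "cmod (w' j) \<le> \<beta> j" "cmod (w j) \<le> \<beta> j"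
            using elim(2) w by (auto simp: polydisc_def)
          ultimately show ?thesis using norm_triangle_ineq4[of "w' j" "w j"] by linarith
        qed
        then show "cmod (coord (Abs_c0 w' - Abs_c0 w) j) \<le> e / 2"
          by (simp add: coord_simps \<beta>_null w elim(2))
      qed
      then show ?case using e by (simp add: dist_norm)
    qed
  qed
  ultimately have "compact (Abs_c0 ` polydisc \<beta>)" by (intro compact_continuous_image)
  also have "Abs_c0 ` polydisc \<beta> = {z. coord z \<in> polydisc \<beta>}"
  proof (intro equalityI subsetI)
    show "z \<in> Abs_c0 ` polydisc \<beta>" if "z \<in> {z. coord z \<in> polydisc \<beta>}" for z
      using that by (intro image_eqI[of _ _ "coord z"]) (simp_all add: coord_inverse)
  qed (auto simp: \<beta>_null)
  finally show ?thesis .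
qed

lemma compact_subset_c0_polydisc:
  assumes K: "compact K"
  obtains \<beta> :: "nat \<Rightarrow> real"
  where "\<beta> \<longlonglongrightarrow> 0" "\<And>j. 0 \<le> \<beta> j" "\<And>z. z \<in> K \<Longrightarrow> coord z \<in> polydisc \<beta>"
proof (cases "K = {}")
  case True
  then show ?thesis by (intro that[of "\<lambda>_. 0"]) auto
next
  case False
  define \<beta> where "\<beta> j = (SUP z\<in>K. cmod (coord z j))" for j
  have "bounded K" using K by (rule compact_imp_bounded)
  then obtain B where B: "\<And>z. z \<in> K \<Longrightarrow> norm z \<le> B" by (auto simp: bounded_iff)
  have bdd: "bdd_above ((\<lambda>z. cmod (coord z j)) ` K)" for j
    using B cmod_coord_le_norm order_trans by (intro bdd_aboveI2[of _ _ B]) blast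
  have le: "cmod (coord z j) \<le> \<beta> j" if "z \<in> K" for z j
    unfolding \<beta>_def using that bdd by (rule cSUP_upper)
  have \<beta>0: "0 \<le> \<beta> j" for j using le False norm_ge_zero order_trans by blast
  have "\<beta> \<longlonglongrightarrow> 0"
  proof (rule LIMSEQ_I)
    fix e :: real assume e: "e > 0"
    then have "e / 4 > 0" by simp
    then obtain F where F: "finite F" "K \<subseteq> (\<Union>x\<in>F. ball x (e / 4))"
      using K unfolding compact_eq_totally_bounded by blast
    have "\<forall>\<^sub>F j in sequentially. \<forall>x\<in>F. cmod (coord x j) < e / 4"
    proof (intro eventually_ball_finite F(1) ballI)
      show "\<forall>\<^sub>F j in sequentially. cmod (coord x j) < e / 4" for x
        using tendstoD[OF coord_tendsto \<open>e / 4 > 0\<close>, of x] by simp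
    qed
    then obtain N where N: "\<And>j x. j \<ge> N \<Longrightarrow> x \<in> F \<Longrightarrow> cmod (coord x j) < e / 4"
      by (auto simp: eventually_sequentially)
    have "\<beta> j \<le> e / 2" if j: "j \<ge> N" for j
      unfolding \<beta>_def
    proof (rule cSUP_least[OF False])
      fix z assume "z \<in> K"
      then obtain x where x: "x \<in> F" "dist x z < e / 4" using F(2) by auto
      have "cmod (coord z j - coord x j) \<le> dist x z"
        using cmod_coord_le_norm[of "z - x" j] by (simp add: coord_simps dist_norm norm_minus_commute)
      then show "cmod (coord z j) \<le> e / 2"
        using norm_triangle_sub[of "coord z j" "coord x j"] N[OF j x(1)] x(2) by linarith
    qed
    then have "norm (\<beta> j - 0) < e" if "j \<ge> N" for j
      using that \<beta>0[of j] e by fastforce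
    then show "\<exists>N. \<forall>j\<ge>N. norm (\<beta> j - 0) < e" by blast
  qed
  then show ?thesis using \<beta>0 le by (intro that[of \<beta>]) (auto simp: polydisc_def)
qed

lemma entire_bounded_near_polydisc:
  fixes \<beta> :: "nat \<Rightarrow> real"
  assumes f: "f \<in> entire_c0" and \<beta>: "\<beta> \<longlonglongrightarrow> 0" "\<And>j. 0 \<le> \<beta> j"
  obtains \<delta> M where "\<delta> > 0"
    "\<And>z. (\<And>j. cmod (coord z j) \<le> \<beta> j + \<delta>) \<Longrightarrow> cmod (f z) \<le> M"
proof -
  let ?T = "{z. coord z \<in> polydisc \<beta>}"
  have T: "compact ?T" by (rule compact_c0_polydisc[OF \<beta>(1)])
  then have "bounded (f ` ?T)"
    by (intro compact_imp_bounded compact_continuous_image continuous_entire f)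
  then obtain M where M: "\<And>z. z \<in> ?T \<Longrightarrow> cmod (f z) \<le> M" by (auto simp: bounded_iff)
  let ?G = "f -` ball 0 (M + 1)"
  have "open ?G" using continuous_entire[OF f] by (intro open_vimage) auto
  moreover have "?T \<subseteq> \<Union>{?G}" using M by force
  ultimately obtain \<eta> where \<eta>: "0 < \<eta>" "\<And>x. x \<in> ?T \<Longrightarrow> \<exists>G\<in>{?G}. ball x \<eta> \<subseteq> G"
    using Heine_Borel_lemma[OF T, of "{?G}"] by blast
  have "cmod (f z) \<le> M + 1" if z: "\<And>j. cmod (coord z j) \<le> \<beta> j + \<eta> / 2" for z
  proof -
    \<comment> \<open>the coordinatewise radial projection of \<open>z\<close> to the compact polydisc\<close>
    define w where "w j = (if cmod (coord z j) \<le> \<beta> j then coord z j else of_real (\<beta> j) * sgn (coord z j))" for j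
    have w: "w \<in> polydisc \<beta>"
      using \<beta>(2) by (auto simp: polydisc_def w_def norm_mult norm_sgn)
    have cw: "coord (Abs_c0 w) = w"
      using w by (intro coord_Abs_c0 null_dominated[OF \<beta>(1)]) (auto simp: polydisc_def)
    have "norm (Abs_c0 w - z) \<le> \<eta> / 2"
    proof (rule norm_c0_leI)
      fix j
      have "cmod (w j - coord z j) \<le> \<eta> / 2"
      proof (cases "cmod (coord z j) \<le> \<beta> j")
        case False
        have nz: "coord z j \<noteq> 0" using False \<beta>(2)[of j] by auto
        have "w j - coord z j = of_real (\<beta> j - cmod (coord z j)) * sgn (coord z j)"
          using False nz by (simp add: w_def sgn_eq field_simps)
        then have "cmod (w j - coord z j) \<le> \<bar>\<beta> j - cmod (coord z j)\<bar>"
          by (simp add: norm_mult norm_sgn del: of_real_diff)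
        then show ?thesis using z[of j] False by simp
      qed (use \<eta> in \<open>simp add: w_def\<close>)
      then show "cmod (coord (Abs_c0 w - z) j) \<le> \<eta> / 2" by (simp add: coord_simps cw)
    qed
    then have "z \<in> ball (Abs_c0 w) \<eta>" using \<eta>(1) by (simp add: dist_norm)
    moreover have "ball (Abs_c0 w) \<eta> \<subseteq> ?G" using \<eta>(2)[of "Abs_c0 w"] w cw by simp
    ultimately have "f z \<in> ball 0 (M + 1)" by blast
    then show ?thesis by simp
  qed
  then show ?thesis using \<eta>(1) by (intro that[of "\<eta> / 2" "M + 1"]) auto
qed

section \<open>Topologies generated by semi-norms\<close>

lemma seminorm_on_zero:
  assumes "seminorm_on E p" "f \<in> E"
  shows "p (\<lambda>_. 0) = 0"
proof -
  have "p (\<lambda>z. 0 * f z) = cmod 0 * p f" using assms unfolding seminorm_on_def by blast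
  then show ?thesis by simp
qed

lemma seminorm_on_triangle:
  "seminorm_on E p \<Longrightarrow> f \<in> E \<Longrightarrow> g \<in> E \<Longrightarrow> p (\<lambda>z. f z + g z) \<le> p f + p g"
  by (simp add: seminorm_on_def)

lemma seminorm_on_nonneg: "seminorm_on E p \<Longrightarrow> f \<in> E \<Longrightarrow> 0 \<le> p f"
  by (simp add: seminorm_on_def)

lemma limitin_seminorm_topology:
  assumes semi: "\<And>p. p \<in> P \<Longrightarrow> seminorm_on E p"
    and diff: "\<And>f g. f \<in> E \<Longrightarrow> g \<in> E \<Longrightarrow> (\<lambda>z. f z - g z) \<in> E"
    and ne: "P \<noteq> {}" and S: "\<And>n. S n \<in> E" and x: "x \<in> E"
  shows "limitin (seminorm_topology E P) S x sequentially \<longleftrightarrow>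
    (\<forall>p\<in>P. (\<lambda>n. p (\<lambda>z. S n z - x z)) \<longlonglongrightarrow> 0)"
proof
  assume lim: "limitin (seminorm_topology E P) S x sequentially"
  show "\<forall>p\<in>P. (\<lambda>n. p (\<lambda>z. S n z - x z)) \<longlonglongrightarrow> 0"
  proof (intro ballI tendstoI)
    fix p and e :: real assume p: "p \<in> P" and e: "e > 0"
    let ?U = "{g \<in> E. p (\<lambda>z. g z - x z) < e}"
    have "openin (seminorm_topology E P) ?U"
      unfolding seminorm_topology_def using p e x
      by (intro topology_generated_by_Basis CollectI exI[of _ x] exI[of _ p] exI[of _ e]) auto
    moreover have "x \<in> ?U" using seminorm_on_zero[OF semi[OF p] x] x e by simp
    ultimately have "\<forall>\<^sub>F n in sequentially. S n \<in> ?U" using lim by (auto simp: limitin_def)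
    then show "\<forall>\<^sub>F n in sequentially. dist (p (\<lambda>z. S n z - x z)) 0 < e"
    proof eventually_elim
      case (elim n)
      have "0 \<le> p (\<lambda>z. S n z - x z)"
        using semi[OF p] diff[OF S[of n] x] by (simp add: seminorm_on_def)
      then show ?case using elim by simp
    qed
  qed
next
  assume lim: "\<forall>p\<in>P. (\<lambda>n. p (\<lambda>z. S n z - x z)) \<longlonglongrightarrow> 0"
  obtain p0 where p0: "p0 \<in> P" using ne by blast
  have "topspace (seminorm_topology E P) = E"
  proof (rule topspace_seminorm_topology[OF p0])
    show "p0 (\<lambda>z. f z - f z) = 0" if "f \<in> E" for f
      using seminorm_on_zero[OF semi[OF p0] that] by simp
  qed
  moreover have "\<forall>\<^sub>F n in sequentially. S n \<in> U"
    if "openin (seminorm_topology E P) U" "x \<in> U" for U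
  proof -
    have "generate_topology_on {{g \<in> E. p (\<lambda>z. g z - f z) < \<epsilon>} | f p \<epsilon>. f \<in> E \<and> p \<in> P \<and> 0 < \<epsilon>} U"
      using that(1) by (simp add: seminorm_topology_def openin_topology_generated_by_iff)
    then show ?thesis using that(2)
    proof (induction U rule: generate_topology_on.induct)
      case (Int a b)
      then show ?case by (auto intro: eventually_conj)
    next
      case (UN \<U>)
      then obtain U where U: "U \<in> \<U>" "x \<in> U" by blast
      from UN.IH[OF this] show ?case by eventually_elim (use U in blast)
    next
      case (Basis U)
      then obtain f p \<epsilon> where U: "U = {g \<in> E. p (\<lambda>z. g z - f z) < \<epsilon>}" and f: "f \<in> E" and p: "p \<in> P"
        by blast
      have "p (\<lambda>z. x z - f z) < \<epsilon>" using Basis U by simp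
      then have "\<forall>\<^sub>F n in sequentially. p (\<lambda>z. S n z - x z) < \<epsilon> - p (\<lambda>z. x z - f z)"
        using lim p by (intro order_tendstoD(2)[of _ 0]) auto
      then show ?case
      proof eventually_elim
        case (elim n)
        have "p (\<lambda>z. (S n z - x z) + (x z - f z)) \<le> p (\<lambda>z. S n z - x z) + p (\<lambda>z. x z - f z)"
          by (rule seminorm_on_triangle[OF semi[OF p] diff[OF S[of n] x] diff[OF x f]])
        then show ?case using elim S[of n] by (simp add: U)
      qed
    qed simp
  qed
  ultimately show "limitin (seminorm_topology E P) S x sequentially"
    using x by (simp add: limitin_def)
qed

lemma cmod_le_SUP:
  assumes "bounded (f ` B)" "z \<in> B"
  shows "cmod (f z) \<le> (SUP z\<in>B. cmod (f z))"
proof (rule cSUP_upper[OF assms(2)])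
  show "bdd_above ((\<lambda>z. cmod (f z)) ` B)"
    using assms(1) by (auto simp: bounded_iff bdd_above_def)
qed

lemma seminorm_on_SUP:
  fixes E :: "('a \<Rightarrow> complex) set"
  assumes B: "B \<noteq> {}" and bd: "\<And>f. f \<in> E \<Longrightarrow> bounded (f ` B)"
  shows "seminorm_on E (\<lambda>f. SUP z\<in>B. cmod (f z))"
proof -
  let ?p = "\<lambda>f. SUP z\<in>B. cmod (f z)"
  have upper: "cmod (f z) \<le> ?p f" if "f \<in> E" "z \<in> B" for f z
    using cmod_le_SUP[OF bd[OF that(1)] that(2)] .
  have nonneg: "0 \<le> ?p f" if "f \<in> E" for f
    using upper[OF that] B norm_ge_zero order_trans by blast
  have "?p (\<lambda>z. c * f z) = cmod c * ?p f" if f: "f \<in> E" for f c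
  proof (rule antisym)
    show le: "?p (\<lambda>z. c * f z) \<le> cmod c * ?p f"
      using upper[OF f] by (intro cSUP_least[OF B]) (simp add: norm_mult mult_left_mono)
    show "cmod c * ?p f \<le> ?p (\<lambda>z. c * f z)"
    proof (cases "c = 0")
      case True
      then show ?thesis using B by simp
    next
      case False
      have bdd: "bdd_above ((\<lambda>z. cmod (c * f z)) ` B)"
        using upper[OF f] by (intro bdd_aboveI2[of _ _ "cmod c * ?p f"]) (simp add: norm_mult mult_left_mono)
      have "?p f \<le> ?p (\<lambda>z. c * f z) / cmod c"
      proof (rule cSUP_least[OF B])
        fix z assume "z \<in> B"
        then have "cmod (c * f z) \<le> ?p (\<lambda>z. c * f z)" using bdd by (intro cSUP_upper)
        then show "cmod (f z) \<le> ?p (\<lambda>z. c * f z) / cmod c"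
          using False by (simp add: norm_mult field_simps)
      qed
      then show ?thesis using False by (simp add: field_simps)
    qed
  qed
  moreover have "?p (\<lambda>z. f z + g z) \<le> ?p f + ?p g" if "f \<in> E" "g \<in> E" for f g
    using upper[OF that(1)] upper[OF that(2)]
    by (intro cSUP_least[OF B]) (meson add_mono norm_triangle_ineq order_trans)
  ultimately show ?thesis using nonneg by (simp add: seminorm_on_def)
qed

section \<open>The monomials form a Schauder basis\<close>

text \<open>
  The closed unit polydisc of the first \<open>L\<close> coordinates.  It is compact, so the supremum over it is a
  continuous semi-norm for both topologies, and it controls the coefficients of all monomials in these
  coordinates.
\<close>

definition unit_polydisc :: "nat \<Rightarrow> c0 set"
  where "unit_polydisc L = {z. coord z \<in> polydisc (\<lambda>j. if j < L then 1 else 0)}"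

lemma compact_unit_polydisc: "compact (unit_polydisc L)"
  unfolding unit_polydisc_def
proof (rule compact_c0_polydisc, rule tendsto_eventually)
  show "\<forall>\<^sub>F j in sequentially. (if j < L then 1 else 0 :: real) = 0"
    using eventually_ge_at_top[of L] by eventually_elim simp
qed

lemma unit_polydisc_nonempty: "unit_polydisc L \<noteq> {}"
proof -
  have "0 \<in> unit_polydisc L" by (auto simp: unit_polydisc_def polydisc_def coord_simps)
  then show ?thesis by blast
qed

lemma entire_bounded_on_compact: "f \<in> entire_c0 \<Longrightarrow> compact K \<Longrightarrow> bounded (f ` K)"
  by (intro compact_imp_bounded compact_continuous_image continuous_entire)

lemma monomial_expansion_unique:
  assumes e: "inj e" and f: "f \<in> entire_c0"
    and lim: "\<And>L. (\<lambda>N. SUP z\<in>unit_polydisc L. cmod ((\<Sum>k<N. a k * monom_c0 (e k) z) - f z)) \<longlonglongrightarrow> 0"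
      "\<And>L. (\<lambda>N. SUP z\<in>unit_polydisc L. cmod ((\<Sum>k<N. b k * monom_c0 (e k) z) - f z)) \<longlonglongrightarrow> 0"
  shows "a = b"
proof
  fix k
  define L where "L = len (e k)"
  let ?r = "\<lambda>j. if j < L then 1 else 0 :: real"
  let ?p = "\<lambda>a N. SUP z\<in>unit_polydisc L. cmod ((\<Sum>k<N. a k * monom_c0 (e k) z) - f z)"
  have upper: "cmod ((\<Sum>k<N. a k * monom_c0 (e k) z) - f z) \<le> ?p a N" if "z \<in> unit_polydisc L" for a N z
    using that
    by (intro cmod_le_SUP[where f = "\<lambda>z. (\<Sum>k<N. a k * monom_c0 (e k) z) - f z"]
        entire_bounded_on_compact entire_diff monomial_sum_entire f compact_unit_polydisc)
  have bound: "cmod (a k - b k) \<le> ?p a N + ?p b N" if N: "k < N" for N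
  proof -
    define c where "c m = a (inv e m) - b (inv e m)" for m
    have c: "c (e i) = a i - b i" for i using e by (simp add: c_def)
    have "cmod (c (e k) * mon (e k) (\<lambda>j. of_real (?r j))) \<le> ?p a N + ?p b N"
    proof (rule coefficient_bound[where X = "e ` {..<N}" and r = ?r])
      fix w assume w: "w \<in> polydisc ?r"
      have "cmod (w j) \<le> (if j < L then 1 else 0)" for j using w by (auto simp: polydisc_def)
      then have "w j = 0" if "\<not> j < L" for j using that by (metis norm_le_zero_iff)
      then have coord_w: "coord (trunc L w) = w" by (auto simp: coord_trunc)
      then have z: "trunc L w \<in> unit_polydisc L" using w by (simp add: unit_polydisc_def)
      have "msum c (e ` {..<N}) w = (\<Sum>i<N. (a i - b i) * monom_c0 (e i) (trunc L w))"
        unfolding msum_def using e by (subst sum.reindex) (auto simp: c monom_c0_eq coord_w intro: inj_on_subset)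
      also have "\<dots> = ((\<Sum>i<N. a i * monom_c0 (e i) (trunc L w)) - f (trunc L w))
          - ((\<Sum>i<N. b i * monom_c0 (e i) (trunc L w)) - f (trunc L w))"
        by (simp add: left_diff_distrib sum_subtractf)
      finally have diff: "msum c (e ` {..<N}) w = \<dots>" .
      show "cmod (msum c (e ` {..<N}) w) \<le> ?p a N + ?p b N"
        unfolding diff by (intro order_trans[OF norm_triangle_ineq4] add_mono upper z)
    qed (use N in \<open>auto simp: polydisc_def\<close>)
    moreover have "mon (e k) (\<lambda>j. of_real (?r j)) = 1"
      unfolding mon_def by (rule prod.neutral) (auto simp: L_def less_len)
    ultimately show ?thesis by (simp add: c)
  qed
  have "(\<lambda>N. ?p a N + ?p b N) \<longlonglongrightarrow> 0 + 0" by (intro tendsto_add lim)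
  then have "cmod (a k - b k) \<le> 0 + 0"
    by (rule tendsto_lowerbound) (use bound in \<open>auto intro: eventually_mono[OF eventually_gt_at_top[of k]]\<close>)
  then show "a k = b k" by simp
qed

text \<open>
  A compact set \<open>K\<close> lies in a compact polydisc, \<open>f\<close> is bounded near four times this polydisc, and
  hence the expansion converges uniformly on a neighbourhood of \<open>K\<close>.
\<close>

lemma taylor_partial_sums_ported:
  assumes e: "compatible_order e" and f: "f \<in> entire_c0"
    and c: "\<And>n L w. hpart f n (trunc L w) = msum c (exponents n {0..<L}) w"
    and p: "seminorm_on entire_c0 p" "compact K" "ported p K"
  shows "(\<lambda>N. p (\<lambda>z. (\<Sum>k<N. c (e k) * monom_c0 (e k) z) - f z)) \<longlonglongrightarrow> 0"
proof -
  obtain \<beta> where \<beta>: "\<beta> \<longlonglongrightarrow> 0" "\<And>j. 0 \<le> \<beta> j" "\<And>z. z \<in> K \<Longrightarrow> coord z \<in> polydisc \<beta>"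
    using compact_subset_c0_polydisc[OF p(2)] by blast
  have "(\<lambda>j. 4 * \<beta> j) \<longlonglongrightarrow> 0" using tendsto_mult_right_zero[OF \<beta>(1)] .
  moreover have "0 \<le> 4 * \<beta> j" for j using \<beta>(2) by simp
  ultimately obtain \<delta> M where \<delta>: "\<delta> > 0"
    and M: "\<And>z. (\<And>j. cmod (coord z j) \<le> 4 * \<beta> j + \<delta>) \<Longrightarrow> cmod (f z) \<le> M"
    using entire_bounded_near_polydisc[OF f, of "\<lambda>j. 4 * \<beta> j"] by metis
  define r where "r j = \<beta> j + \<delta> / 4" for j
  have r: "0 < r j" for j using \<beta>(2)[of j] \<delta> by (simp add: r_def)
  have bd: "cmod (f z) \<le> M" if "\<And>j. cmod (coord z j) \<le> 4 * r j" for z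
    using that by (intro M) (simp add: r_def)
  define V where "V = (\<Union>x\<in>K. ball x (\<delta> / 4))"
  have V: "open V" "K \<subseteq> V" using \<delta> by (auto simp: V_def)
  have V_polydisc: "coord z \<in> polydisc r" if zV: "z \<in> V" for z
  proof -
    obtain x where x: "x \<in> K" "dist x z < \<delta> / 4" using zV by (auto simp: V_def)
    have "cmod (coord z j) \<le> r j" for j
    proof -
      have "cmod (coord z j - coord x j) \<le> dist x z"
        using cmod_coord_le_norm[of "z - x" j] by (simp add: coord_simps dist_norm norm_minus_commute)
      moreover have "cmod (coord x j) \<le> \<beta> j" using \<beta>(3)[OF x(1)] by (simp add: polydisc_def)
      ultimately show ?thesis
        using norm_triangle_sub[of "coord z j" "coord x j"] x(2) unfolding r_def by linarith
    qed
    then show ?thesis by (simp add: polydisc_def)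
  qed
  obtain C where C: "C > 0"
    and Cp: "\<And>g. g \<in> entire_c0 \<Longrightarrow> ennreal (p g) \<le> ennreal C * (SUP z\<in>V. ennreal (cmod (g z)))"
    using p(3)[unfolded ported_def, THEN spec, THEN mp, OF conjI[OF V]] by auto
  show ?thesis
  proof (rule LIMSEQ_I)
    fix \<epsilon> :: real assume \<epsilon>: "\<epsilon> > 0"
    define \<epsilon>' where "\<epsilon>' = \<epsilon> / (2 * C)"
    have \<epsilon>': "\<epsilon>' > 0" using \<epsilon> C by (simp add: \<epsilon>'_def)
    obtain N0 where N0: "\<And>N z. N \<ge> N0 \<Longrightarrow> coord z \<in> polydisc r \<Longrightarrow>
        cmod (f z - (\<Sum>k<N. c (e k) * monom_c0 (e k) z)) \<le> \<epsilon>'"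
      using monomial_expansion_uniform[where r = r and M = M, OF e f c r bd \<epsilon>'] by blast
    have "norm (p (\<lambda>z. (\<Sum>k<N. c (e k) * monom_c0 (e k) z) - f z) - 0) < \<epsilon>" if N: "N \<ge> N0" for N
    proof -
      let ?g = "\<lambda>z. (\<Sum>k<N. c (e k) * monom_c0 (e k) z) - f z"
      have g: "?g \<in> entire_c0" by (intro entire_diff monomial_sum_entire f)
      have "(SUP z\<in>V. ennreal (cmod (?g z))) \<le> ennreal \<epsilon>'"
        using N0[OF N V_polydisc] by (intro SUP_least ennreal_leI) (simp add: norm_minus_commute)
      then have "ennreal (p ?g) \<le> ennreal C * ennreal \<epsilon>'"
        using order_trans[OF Cp[OF g] mult_left_mono] by simp
      then have "p ?g \<le> C * \<epsilon>'" using C \<epsilon>' by (simp flip: ennreal_mult)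
      also have "\<dots> < \<epsilon>" using C \<epsilon> by (simp add: \<epsilon>'_def)
      finally show ?thesis using p(1) g by (simp add: seminorm_on_def)
    qed
    then show "\<exists>N0. \<forall>N\<ge>N0. norm (p (\<lambda>z. (\<Sum>k<N. c (e k) * monom_c0 (e k) z) - f z) - 0) < \<epsilon>" by blast
  qed
qed

lemma ported_SUP_compact: "K \<noteq> {} \<Longrightarrow> compact K \<Longrightarrow> ported (\<lambda>f. SUP z\<in>K. cmod (f z)) K"
  unfolding ported_def
proof (intro allI impI exI[of _ 1] conjI ballI)
  fix V f assume K: "K \<noteq> {}" "compact K" and V: "open V \<and> K \<subseteq> V" and f: "f \<in> entire_c0"
  obtain z where z: "z \<in> K" "\<And>y. y \<in> K \<Longrightarrow> cmod (f y) \<le> cmod (f z)"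
    using continuous_attains_sup[OF K(2,1), of "\<lambda>z. cmod (f z)"] continuous_entire[OF f]
    by (auto intro: continuous_on_norm)
  have "(SUP z\<in>K. cmod (f z)) \<le> cmod (f z)" using z(2) by (intro cSUP_least K)
  then have "ennreal (SUP z\<in>K. cmod (f z)) \<le> ennreal (cmod (f z))" by (rule ennreal_leI)
  also have "\<dots> \<le> (SUP z\<in>V. ennreal (cmod (f z)))" using z(1) V by (intro SUP_upper) blast
  finally show "ennreal (SUP z\<in>K. cmod (f z)) \<le> ennreal 1 * (SUP z\<in>V. ennreal (cmod (f z)))" by simp
qed simp

theorem monomials_schauder_basis_tau_omega:
  assumes e: "compatible_order e"
  shows "schauder_basis tau_omega (\<lambda>k. monom_c0 (e k))"
  unfolding schauder_basis_def topspace_tau_omega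
proof (intro conjI ballI)
  let ?P = "{p. seminorm_on entire_c0 p \<and> (\<exists>K. compact K \<and> ported p K)}"
  have sup_in: "(\<lambda>f. SUP z\<in>unit_polydisc L. cmod (f z)) \<in> ?P" for L
    using unit_polydisc_nonempty[of L] compact_unit_polydisc[of L]
    by (auto intro!: seminorm_on_SUP entire_bounded_on_compact ported_SUP_compact)
  show "range (\<lambda>k. monom_c0 (e k)) \<subseteq> entire_c0"
  proof (intro image_subsetI)
    show "monom_c0 (e k) \<in> entire_c0" for k
      using monomial_sum_entire[of "\<lambda>_. 1" e "{k}"] by simp
  qed
  fix f assume f: "f \<in> entire_c0"
  have lim_iff: "limitin tau_omega (\<lambda>N z. \<Sum>k<N. a k * monom_c0 (e k) z) f sequentially \<longleftrightarrow>
      (\<forall>p\<in>?P. (\<lambda>N. p (\<lambda>z. (\<Sum>k<N. a k * monom_c0 (e k) z) - f z)) \<longlonglongrightarrow> 0)" for a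
    unfolding tau_omega_def
  proof (rule limitin_seminorm_topology)
    show "?P \<noteq> {}" using sup_in[of 0] by blast
  qed (auto intro: f entire_diff monomial_sum_entire)
  obtain c where c: "\<And>n L w. hpart f n (trunc L w) = msum c (exponents n {0..<L}) w"
    using taylor_coefficients_exist[OF f] by blast
  show "\<exists>!a. limitin tau_omega (\<lambda>N z. \<Sum>k<N. a k * monom_c0 (e k) z) f sequentially"
  proof (rule ex1I)
    show "limitin tau_omega (\<lambda>N z. \<Sum>k<N. c (e k) * monom_c0 (e k) z) f sequentially"
      unfolding lim_iff using taylor_partial_sums_ported[OF e f c] by blast
    then have "\<forall>p\<in>?P. (\<lambda>N. p (\<lambda>z. (\<Sum>k<N. c (e k) * monom_c0 (e k) z) - f z)) \<longlonglongrightarrow> 0"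
      unfolding lim_iff .
    note c_lim = bspec[OF this sup_in]
    fix a assume "limitin tau_omega (\<lambda>N z. \<Sum>k<N. a k * monom_c0 (e k) z) f sequentially"
    then have "\<forall>p\<in>?P. (\<lambda>N. p (\<lambda>z. (\<Sum>k<N. a k * monom_c0 (e k) z) - f z)) \<longlonglongrightarrow> 0"
      unfolding lim_iff .
    note a_lim = bspec[OF this sup_in]
    show "a = (\<lambda>k. c (e k))"
      by (rule monomial_expansion_unique[OF _ f a_lim c_lim])
        (use e in \<open>simp add: compatible_order_def bij_is_inj\<close>)
  qed
qed

lemma monomial_sum_entire_b: "(\<lambda>z. \<Sum>k\<in>A. a k * monom_c0 (e k) z) \<in> entire_b_c0"
  unfolding entire_b_c0_def
proof (intro CollectI conjI allI impI monomial_sum_entire)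
  fix B :: "c0 set" assume "bounded B"
  then obtain R where R: "\<And>z. z \<in> B \<Longrightarrow> norm z \<le> R" by (auto simp: bounded_iff)
  have "cmod (monom_c0 m z) \<le> (\<Prod>i\<in>Poly_Mapping.keys m. R ^ Poly_Mapping.lookup m i)" if "z \<in> B" for m z
    unfolding monom_c0_def prod_norm[symmetric] norm_power
    by (intro prod_mono conjI power_mono zero_le_power norm_ge_zero order_trans[OF cmod_coord_le_norm R[OF that]])
  then have "cmod (\<Sum>k\<in>A. a k * monom_c0 (e k) z)
      \<le> (\<Sum>k\<in>A. cmod (a k) * (\<Prod>i\<in>Poly_Mapping.keys (e k). R ^ Poly_Mapping.lookup (e k) i))" if "z \<in> B" for z
    using that by (intro sum_norm_le) (simp add: norm_mult mult_left_mono)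
  then show "bounded ((\<lambda>z. \<Sum>k\<in>A. a k * monom_c0 (e k) z) ` B)"
    by (auto simp: bounded_iff)
qed

lemma entire_b_imp_entire: "f \<in> entire_b_c0 \<Longrightarrow> f \<in> entire_c0"
  by (simp add: entire_b_c0_def)

lemma entire_b_bounded: "f \<in> entire_b_c0 \<Longrightarrow> bounded B \<Longrightarrow> bounded (f ` B)"
  by (simp add: entire_b_c0_def)

lemma entire_b_diff:
  assumes "f \<in> entire_b_c0" "g \<in> entire_b_c0"
  shows "(\<lambda>z. f z - g z) \<in> entire_b_c0"
proof -
  have "bounded ((\<lambda>z. f z - g z) ` B)" if "bounded B" for B
    using assms that by (intro bounded_minus_comp entire_b_bounded)
  then show ?thesis
    using assms entire_diff[of f g] by (simp add: entire_b_c0_def)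
qed

lemma taylor_partial_sums_bounded:
  assumes e: "compatible_order e" and f: "f \<in> entire_b_c0"
    and c: "\<And>n L w. hpart f n (trunc L w) = msum c (exponents n {0..<L}) w"
    and B: "bounded B" "B \<noteq> {}"
  shows "(\<lambda>N. SUP z\<in>B. cmod ((\<Sum>k<N. c (e k) * monom_c0 (e k) z) - f z)) \<longlonglongrightarrow> 0"
proof -
  obtain R where R: "R > 0" "\<And>z. z \<in> B \<Longrightarrow> norm z \<le> R" using B(1) by (auto simp: bounded_pos)
  have "bounded (f ` cball 0 (4 * R))" using entire_b_bounded[OF f] by simp
  then obtain M where "\<forall>z\<in>cball 0 (4 * R). cmod (f z) \<le> M" by (auto simp: bounded_iff)
  then have M: "cmod (f z) \<le> M" if "norm z \<le> 4 * R" for z using that by simp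
  have bd: "cmod (f z) \<le> M" if "\<And>j. cmod (coord z j) \<le> 4 * (\<lambda>_. R) j" for z
    using that by (intro M norm_c0_leI) simp
  show ?thesis
  proof (rule LIMSEQ_I)
    fix \<epsilon> :: real assume \<epsilon>: "\<epsilon> > 0"
    then have "\<epsilon> / 2 > 0" by simp
    then obtain N0 where N0: "\<And>N z. N \<ge> N0 \<Longrightarrow> coord z \<in> polydisc (\<lambda>_. R) \<Longrightarrow>
        cmod (f z - (\<Sum>k<N. c (e k) * monom_c0 (e k) z)) \<le> \<epsilon> / 2"
      using monomial_expansion_uniform[where r = "\<lambda>_. R" and M = M, OF e entire_b_imp_entire[OF f] c R(1) bd]
      by blast
    have "norm ((SUP z\<in>B. cmod ((\<Sum>k<N. c (e k) * monom_c0 (e k) z) - f z)) - 0) < \<epsilon>" if N: "N \<ge> N0" for N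
    proof -
      let ?g = "\<lambda>z. (\<Sum>k<N. c (e k) * monom_c0 (e k) z) - f z"
      have "cmod (?g z) \<le> \<epsilon> / 2" if "z \<in> B" for z
        using N0[OF N, of z] R(2)[OF that] cmod_coord_le_norm[of z] order_trans
        by (fastforce simp: polydisc_def norm_minus_commute)
      then have "(SUP z\<in>B. cmod (?g z)) \<le> \<epsilon> / 2" by (intro cSUP_least B)
      moreover have "0 \<le> (SUP z\<in>B. cmod (?g z))"
      proof -
        have "seminorm_on entire_b_c0 (\<lambda>f. SUP z\<in>B. cmod (f z))"
          using B by (intro seminorm_on_SUP entire_b_bounded)
        moreover have "?g \<in> entire_b_c0" by (intro entire_b_diff monomial_sum_entire_b f)
        ultimately show ?thesis by (rule seminorm_on_nonneg)
      qed
      ultimately show ?thesis using \<epsilon> by simp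
    qed
    then show "\<exists>N0. \<forall>N\<ge>N0. norm ((SUP z\<in>B. cmod ((\<Sum>k<N. c (e k) * monom_c0 (e k) z) - f z)) - 0) < \<epsilon>"
      by blast
  qed
qed

theorem monomials_schauder_basis_tau_b:
  assumes e: "compatible_order e"
  shows "schauder_basis tau_b (\<lambda>k. monom_c0 (e k))"
  unfolding schauder_basis_def topspace_tau_b
proof (intro conjI ballI)
  let ?P = "{\<lambda>f. SUP z\<in>B. cmod (f z) | B. bounded B \<and> B \<noteq> {}} :: ((c0 \<Rightarrow> complex) \<Rightarrow> real) set"
  have sup_in: "(\<lambda>f. SUP z\<in>unit_polydisc L. cmod (f z)) \<in> ?P" for L
    using unit_polydisc_nonempty[of L] compact_imp_bounded[OF compact_unit_polydisc[of L]] by blast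
  show "range (\<lambda>k. monom_c0 (e k)) \<subseteq> entire_b_c0"
  proof (intro image_subsetI)
    show "monom_c0 (e k) \<in> entire_b_c0" for k
      using monomial_sum_entire_b[of "\<lambda>_. 1" e "{k}"] by simp
  qed
  fix f assume f: "f \<in> entire_b_c0"
  have semi: "seminorm_on entire_b_c0 p" if "p \<in> ?P" for p
    using that by (auto intro!: seminorm_on_SUP entire_b_bounded)
  have lim_iff: "limitin tau_b (\<lambda>N z. \<Sum>k<N. a k * monom_c0 (e k) z) f sequentially \<longleftrightarrow>
      (\<forall>p\<in>?P. (\<lambda>N. p (\<lambda>z. (\<Sum>k<N. a k * monom_c0 (e k) z) - f z)) \<longlonglongrightarrow> 0)" for a
    unfolding tau_b_def
    using sup_in[of 0] f
    by (intro limitin_seminorm_topology semi entire_b_diff monomial_sum_entire_b) blast+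
  obtain c where c: "\<And>n L w. hpart f n (trunc L w) = msum c (exponents n {0..<L}) w"
    using taylor_coefficients_exist[OF entire_b_imp_entire[OF f]] by blast
  show "\<exists>!a. limitin tau_b (\<lambda>N z. \<Sum>k<N. a k * monom_c0 (e k) z) f sequentially"
  proof (rule ex1I)
    show "limitin tau_b (\<lambda>N z. \<Sum>k<N. c (e k) * monom_c0 (e k) z) f sequentially"
      unfolding lim_iff using taylor_partial_sums_bounded[OF e f c] by auto
    then have "\<forall>p\<in>?P. (\<lambda>N. p (\<lambda>z. (\<Sum>k<N. c (e k) * monom_c0 (e k) z) - f z)) \<longlonglongrightarrow> 0"
      unfolding lim_iff .
    note c_lim = bspec[OF this sup_in]
    fix a assume "limitin tau_b (\<lambda>N z. \<Sum>k<N. a k * monom_c0 (e k) z) f sequentially"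
    then have "\<forall>p\<in>?P. (\<lambda>N. p (\<lambda>z. (\<Sum>k<N. a k * monom_c0 (e k) z) - f z)) \<longlonglongrightarrow> 0"
      unfolding lim_iff .
    note a_lim = bspec[OF this sup_in]
    show "a = (\<lambda>k. c (e k))"
      by (rule monomial_expansion_unique[OF _ entire_b_imp_entire[OF f] a_lim c_lim])
        (use e in \<open>simp add: compatible_order_def bij_is_inj\<close>)
  qed
qed

theorem theorem2:
  fixes e :: "nat \<Rightarrow> (nat \<Rightarrow>\<^sub>0 nat)"
  assumes "compatible_order e"
  shows "schauder_basis tau_omega (\<lambda>k. monom_c0 (e k)) \<and>
    schauder_basis tau_b (\<lambda>k. monom_c0 (e k))"
  using assms by (intro conjI monomials_schauder_basis_tau_omega monomials_schauder_basis_tau_b)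

end
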